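(* Let $(A,p_l)$ be a non-unital Fréchet algebra and let $n\in\mathbb{N}$. Then: (i) if $A^{\#}$ is $n$-ideally amenable, then $A$ is $n$-ideally amenable; (ii) if $A$ is $(2n-1)$-ideally amenable, then $A^{\#}$ is $(2n-1)$-ideally amenable.
   Context: All spaces are complex and $\mathbb{N}=\{1,2,\dots\}$. A Fréchet algebra $(A,p_l)$ is an algebra that is complete and Hausdorff for the topology generated by a separating, increasing sequence $(p_l)_{l\in\mathbb{N}}$ of submultiplicative seminorms. The unitization of $A$ is $A^{\#}=A\oplus\mathbb{C}e$ with product $(a,\lambda)(b,\mu)=(ab+\mu a+\lambda b,\lambda\mu)$ and seminorms $q_l(a,\lambda)=p_l(a)+|\lambda|$; it is a Fréchet algebra with identity $e=(0,1)$. For a locally convex space $X$, $X^*$ is its continuous dual with the strong topology (uniform convergence on bounded subsets of $X$); $X^{(0)}=X$ and $X^{(n)}=(X^{(n-1)})^*$. If $B$ is a Fréchet algebra and $X$ a locally convex $B$-bimodule, then $X^*$ is a $B$-bimodule via $\langle b\cdot f,x\rangle=\langle f,x\cdot b\rangle$ and $\langle f\cdot b,x\rangle=\langle f,b\cdot x\rangle$; iterating, every $X^{(n)}$ is a $B$-bimodule. A closed two-sided ideal $I$ of $B$ is a $B$-bimodule by multiplication. A continuous derivation $D:B\to X$ is a continuous linear map with $D(ab)=a\cdot D(b)+D(a)\cdot b$ for all $a,b\in B$; it is inner if there is $x\in X$ with $D(b)=b\cdot x-x\cdot b$ for all $b\in B$. $B$ is $n$-ideally amenable if for every closed two-sided ideal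 $I$ of $B$, every continuous derivation $B\to I^{(n)}$ is inner. *)

theory Defs
  imports "HOL-Analysis.Analysis"
begin

section \<open>Complex algebras and Frechet algebras\<close>

text \<open>The complex analogue of the library class \<open>real_algebra\<close>: associative, no identity required.\<close>

class complex_algebra = ring +
  fixes scaleC :: "complex \<Rightarrow> 'a \<Rightarrow> 'a"  (infixr \<open>*\<^sub>C\<close> 75)
  assumes scaleC_add_right: "c *\<^sub>C (x + y) = c *\<^sub>C x + c *\<^sub>C y"
    and scaleC_add_left: "(c + d) *\<^sub>C x = c *\<^sub>C x + d *\<^sub>C x"
    and scaleC_scaleC: "c *\<^sub>C d *\<^sub>C x = (c * d) *\<^sub>C x"
    and scaleC_one: "1 *\<^sub>C x = x"
    and mult_scaleC_left: "(c *\<^sub>C x) * y = c *\<^sub>C (x * y)"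
    and mult_scaleC_right: "x * (c *\<^sub>C y) = c *\<^sub>C (x * y)"

definition unital_algebra :: "'a::complex_algebra itself \<Rightarrow> bool"
  where "unital_algebra _ \<longleftrightarrow> (\<exists>e::'a. \<forall>x. e * x = x \<and> x * e = x)"

definition submult_seminorm :: "('a::complex_algebra \<Rightarrow> real) \<Rightarrow> bool"
  where "submult_seminorm p \<longleftrightarrow>
    (\<forall>x y. p (x + y) \<le> p x + p y) \<and>
    (\<forall>c x. p (c *\<^sub>C x) = cmod c * p x) \<and>
    (\<forall>x y. p (x * y) \<le> p x * p y)"

definition seminorm_topology :: "(nat \<Rightarrow> 'a::complex_algebra \<Rightarrow> real) \<Rightarrow> 'a topology"
  where "seminorm_topology p =
    topology_generated_by {{y. p l (y - x) < r} | l x r. 0 < r}"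

text \<open>
  The sequence of seminorms is indexed from 0.  The topology is generated by countably many
  seminorms, so completeness is completeness for Cauchy sequences.
\<close>

definition frechet_algebra :: "(nat \<Rightarrow> 'a::complex_algebra \<Rightarrow> real) \<Rightarrow> bool"
  where "frechet_algebra p \<longleftrightarrow>
    (\<forall>l. submult_seminorm (p l)) \<and>
    (\<forall>l x. p l x \<le> p (Suc l) x) \<and>
    (\<forall>x. (\<forall>l. p l x = 0) \<longrightarrow> x = 0) \<and>
    (\<forall>s::nat \<Rightarrow> 'a.
       (\<forall>l. \<forall>r>0. \<exists>N. \<forall>i\<ge>N. \<forall>j\<ge>N. p l (s i - s j) < r) \<longrightarrow>
       (\<exists>x. limitin (seminorm_topology p) s x sequentially))"

definition closed_ideal :: "(nat \<Rightarrow> 'a::complex_algebra \<Rightarrow> real) \<Rightarrow> 'a set \<Rightarrow> bool"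
  where "closed_ideal p I \<longleftrightarrow>
    module.subspace scaleC I \<and>
    (\<forall>a. \<forall>x\<in>I. a * x \<in> I \<and> x * a \<in> I) \<and>
    closedin (seminorm_topology p) I"


section \<open>Unitization\<close>

datatype 'a unitization = Unitization (algebra_part: 'a) (scalar_part: complex)

instantiation unitization :: (complex_algebra) complex_algebra
begin

definition "0 = Unitization 0 0"
definition "x + y =
  Unitization (algebra_part x + algebra_part y) (scalar_part x + scalar_part y)"
definition "- x = Unitization (- algebra_part x) (- scalar_part x)"
definition "x - y =
  Unitization (algebra_part x - algebra_part y) (scalar_part x - scalar_part y)"
definition "x * y =
  Unitization
    (algebra_part x * algebra_part y
      + scalar_part y *\<^sub>C algebra_part x + scalar_part x *\<^sub>C algebra_part y)
    (scalar_part x * scalar_part y)"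
definition "c *\<^sub>C x = Unitization (c *\<^sub>C algebra_part x) (c * scalar_part x)"

instance
  by standard
    (simp_all add: zero_unitization_def plus_unitization_def uminus_unitization_def
      minus_unitization_def times_unitization_def scaleC_unitization_def algebra_simps
      scaleC_add_right scaleC_add_left scaleC_scaleC scaleC_one
      mult_scaleC_left mult_scaleC_right)

end

definition unitization_seminorms ::
    "(nat \<Rightarrow> 'a::complex_algebra \<Rightarrow> real) \<Rightarrow> nat \<Rightarrow> 'a unitization \<Rightarrow> real"
  where "unitization_seminorms p l x = p l (algebra_part x) + cmod (scalar_part x)"


section \<open>Locally convex bimodules and strong duals\<close>

text \<open>
  A structure whose underlying set is the \<open>topspace\<close> of its topology; \<open>'b\<close> is the type of
  the algebra that acts.  The operations are relevant on the underlying set only.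
\<close>

record ('b, 'x) bimodule =
  mtop :: "'x topology"
  mzero :: 'x
  madd :: "'x \<Rightarrow> 'x \<Rightarrow> 'x"
  mscale :: "complex \<Rightarrow> 'x \<Rightarrow> 'x"
  lact :: "'b \<Rightarrow> 'x \<Rightarrow> 'x"
  ract :: "'x \<Rightarrow> 'b \<Rightarrow> 'x"

abbreviation mcarrier :: "('b, 'x) bimodule \<Rightarrow> 'x set"
  where "mcarrier X \<equiv> topspace (mtop X)"

definition ideal_bimodule ::
    "(nat \<Rightarrow> 'a::complex_algebra \<Rightarrow> real) \<Rightarrow> 'a set \<Rightarrow> ('a, 'a) bimodule"
  where "ideal_bimodule p I =
    \<lparr> mtop = subtopology (seminorm_topology p) I, mzero = 0, madd = (+), mscale = scaleC,
      lact = (*), ract = (*) \<rparr>"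

text \<open>Von Neumann boundedness.\<close>

definition mbounded_in :: "('b, 'x) bimodule \<Rightarrow> 'x set \<Rightarrow> bool"
  where "mbounded_in X S \<longleftrightarrow> S \<subseteq> mcarrier X \<and>
    (\<forall>U. openin (mtop X) U \<and> mzero X \<in> U \<longrightarrow>
       (\<exists>s>0. \<forall>t>s. S \<subseteq> mscale X (complex_of_real t) ` U))"

text \<open>Functionals on \<open>X\<close> are made unique as HOL functions by being \<open>undefined\<close> off the carrier.\<close>

definition continuous_functionals :: "('b, 'x) bimodule \<Rightarrow> ('x \<Rightarrow> complex) set"
  where "continuous_functionals X =
    {f \<in> extensional (mcarrier X).
       continuous_map (mtop X) euclidean f \<and>
       (\<forall>x\<in>mcarrier X. \<forall>y\<in>mcarrier X. f (madd X x y) = f x + f y) \<and>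
       (\<forall>c. \<forall>x\<in>mcarrier X. f (mscale X c x) = c * f x)}"

text \<open>
  The sets generating the topology are the balls \<open>sup {|g x - f x| | x \<in> S} < r\<close>, with \<open>S\<close> bounded;
  the bound \<open>d < r\<close> expresses that the supremum, which need not be attained, is below \<open>r\<close>.
\<close>

definition strong_topology :: "('b, 'x) bimodule \<Rightarrow> ('x \<Rightarrow> complex) topology"
  where "strong_topology X = topology_generated_by
    {{g \<in> continuous_functionals X. \<exists>d<r. \<forall>x\<in>S. cmod (g x - f x) \<le> d} | f S r.
       f \<in> continuous_functionals X \<and> mbounded_in X S \<and> 0 < r}"

definition strong_dual :: "('b, 'x) bimodule \<Rightarrow> ('b, 'x \<Rightarrow> complex) bimodule"
  where "strong_dual X =
    \<lparr> mtop = strong_topology X,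
      mzero = (\<lambda>x\<in>mcarrier X. 0),
      madd = (\<lambda>f g. \<lambda>x\<in>mcarrier X. f x + g x),
      mscale = (\<lambda>c f. \<lambda>x\<in>mcarrier X. c * f x),
      lact = (\<lambda>b f. \<lambda>x\<in>mcarrier X. f (ract X x b)),
      ract = (\<lambda>f b. \<lambda>x\<in>mcarrier X. f (lact X b x)) \<rparr>"


section \<open>Iterated duals inside one type\<close>

text \<open>
  The type of \<open>strong_dual X\<close> is larger than that of \<open>X\<close>, whereas a family indexed by \<open>n\<close> has to
  live in one type.  So after each dualisation the bimodule is replaced by an isomorphic copy
  inside a fixed type \<open>'u\<close>: \<open>copy_map X\<close> is an injection of the carrier into \<open>'u\<close>, and
  \<open>copy X\<close> is the structure transported along it.  This is meaningful only if the type \<open>'u\<close> is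
  large enough for such injections to exist at each stage; this is what \<open>room_for_duals\<close> says.
\<close>

definition copy_map :: "('b, 'x) bimodule \<Rightarrow> 'x \<Rightarrow> 'u"
  where "copy_map X = (SOME c. inj_on c (mcarrier X))"

definition copy_inv :: "('b, 'x) bimodule \<Rightarrow> 'u \<Rightarrow> 'x"
  where "copy_inv X = inv_into (mcarrier X) (copy_map X)"

definition copy :: "('b, 'x) bimodule \<Rightarrow> ('b, 'u) bimodule"
  where "copy X =
    \<lparr> mtop = pullback_topology (copy_map X ` mcarrier X) (copy_inv X) (mtop X),
      mzero = copy_map X (mzero X),
      madd = (\<lambda>x y. copy_map X (madd X (copy_inv X x) (copy_inv X y))),
      mscale = (\<lambda>c x. copy_map X (mscale X c (copy_inv X x))),
      lact = (\<lambda>b x. copy_map X (lact X b (copy_inv X x))),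
      ract = (\<lambda>x b. copy_map X (ract X (copy_inv X x) b)) \<rparr>"

primrec iterated_dual :: "nat \<Rightarrow> ('b, 'x) bimodule \<Rightarrow> ('b, 'u) bimodule"
  where
    "iterated_dual 0 X = copy X"
  | "iterated_dual (Suc n) X = copy (strong_dual (iterated_dual n X :: ('b, 'u) bimodule))"

text \<open>
  A bound on sizes only: \<open>S k\<close> has room for the \<open>k\<close>-th iterated dual of any bimodule with carrier
  in \<open>'b\<close>.  For each \<open>n\<close> there is such a type; see \<open>room_for_duals_0\<close> and \<open>room_for_duals_Suc\<close>.
\<close>

definition room_for_duals :: "'b itself \<Rightarrow> 'u itself \<Rightarrow> nat \<Rightarrow> bool"
  where "room_for_duals _ _ n \<longleftrightarrow>
    (\<exists>S :: nat \<Rightarrow> 'u set. (UNIV :: 'b set) \<lesssim> S 0 \<and>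
       (\<forall>k<n. (S k \<rightarrow>\<^sub>E (UNIV :: complex set)) \<lesssim> S (Suc k)))"

lemma room_for_duals_0: "room_for_duals TYPE('b) TYPE('b) 0"
  unfolding room_for_duals_def by (auto intro!: exI[of _ "\<lambda>_. UNIV"])

lemma room_for_duals_Suc:
  assumes "room_for_duals TYPE('b) TYPE('u) n"
  shows "room_for_duals TYPE('b) TYPE('u \<Rightarrow> complex) (Suc n)"
proof -
  obtain S :: "nat \<Rightarrow> 'u set" where S: "(UNIV :: 'b set) \<lesssim> S 0"
    "\<And>k. k < n \<Longrightarrow> (S k \<rightarrow>\<^sub>E (UNIV :: complex set)) \<lesssim> S (Suc k)"
    using assms unfolding room_for_duals_def by blast
  define e where "e = (\<lambda>(u::'u) v. if v = u then 1 else (0::complex))"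
  have "inj e"
    unfolding e_def by (rule injI) (metis zero_neq_one)
  then have ep: "A \<approx> e ` A" for A
    by (meson eqpoll_sym inj_on_image_eqpoll_self inj_on_subset subset_UNIV)
  have up: "(e ` A \<rightarrow>\<^sub>E (UNIV :: complex set)) \<lesssim> (A \<rightarrow>\<^sub>E (UNIV :: complex set))" for A
    unfolding lepoll_def
  proof (intro exI conjI)
    show "inj_on (\<lambda>f. restrict (f \<circ> e) A) (e ` A \<rightarrow>\<^sub>E (UNIV :: complex set))"
    proof (rule inj_onI)
      fix f g
      assume f: "f \<in> e ` A \<rightarrow>\<^sub>E (UNIV :: complex set)"
        and g: "g \<in> e ` A \<rightarrow>\<^sub>E (UNIV :: complex set)"
        and eq: "restrict (f \<circ> e) A = restrict (g \<circ> e) A"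
      have "f (e a) = g (e a)" if "a \<in> A" for a
        using fun_cong[OF eq, of a] that by simp
      then show "f = g"
        using f g by (intro PiE_ext[of f _ _ g]) auto
    qed
  qed auto
  define T where "T = (\<lambda>k. if k \<le> n then e ` S k else UNIV)"
  have "(T k \<rightarrow>\<^sub>E (UNIV :: complex set)) \<lesssim> T (Suc k)" if "k < Suc n" for k
  proof (cases "k < n")
    case True
    then show ?thesis
      using S(2) up ep unfolding T_def
      by (simp add: Suc_le_eq) (meson eqpoll_imp_lepoll lepoll_trans)
  next
    case False
    then have "k = n" using that by simp
    then show ?thesis
      using up[of "S n"] unfolding T_def
      by simp (meson lepoll_trans subset_UNIV subset_imp_lepoll)
  qed
  moreover have "(UNIV :: 'b set) \<lesssim> T 0"
    using S(1) ep[of "S 0"] unfolding T_def by (simp add: eqpoll_imp_lepoll lepoll_trans1 lepoll_trans2)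
  ultimately show ?thesis
    unfolding room_for_duals_def by blast
qed

lemma mcarrier_strong_dual: "mcarrier (strong_dual X) = continuous_functionals X"
proof
  show "mcarrier (strong_dual X) \<subseteq> continuous_functionals X"
    by (auto simp: strong_dual_def strong_topology_def topology_generated_by_topspace)
  have "mbounded_in X {}"
    by (auto simp: mbounded_in_def intro: exI[of _ 1])
  then have "f \<in> mcarrier (strong_dual X)" if "f \<in> continuous_functionals X" for f
    using that zero_less_one[where 'a = real]
    unfolding strong_dual_def strong_topology_def topology_generated_by_topspace
    by (simp, intro exI[of _ "continuous_functionals X"] conjI exI[of _ f] exI[of _ "{}"] exI[of _ "1::real"])
      (auto intro: exI[of _ "0::real"])
  then show "continuous_functionals X \<subseteq> mcarrier (strong_dual X)"
    by blast
qed

lemma inj_on_copy_map: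
  assumes "mcarrier X \<lesssim> (S :: 'u set)"
  shows "inj_on (copy_map X :: _ \<Rightarrow> 'u) (mcarrier X)"
proof -
  have "\<exists>c :: _ \<Rightarrow> 'u. inj_on c (mcarrier X)"
    using assms unfolding lepoll_def by blast
  then show ?thesis
    unfolding copy_map_def by (rule someI_ex)
qed

lemma mcarrier_copy:
  assumes "inj_on (copy_map X :: _ \<Rightarrow> 'u) (mcarrier X)"
  shows "mcarrier (copy X :: ('b, 'u) bimodule) = copy_map X ` mcarrier X"
  using assms by (auto simp: copy_def topspace_pullback_topology copy_inv_def)

text \<open>With enough room, all the copies used in the first \<open>n\<close> iterated duals are faithful.\<close>

lemma room_for_duals_inj_on_copy_map:
  fixes X :: "('b, 'x) bimodule"
  assumes room: "room_for_duals TYPE('c) TYPE('u) n"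
    and X: "mcarrier X \<lesssim> (UNIV :: 'c set)"
  shows "inj_on (copy_map X :: 'x \<Rightarrow> 'u) (mcarrier X)"
    and "k < n \<Longrightarrow>
      inj_on (copy_map (strong_dual (iterated_dual k X :: ('b, 'u) bimodule)) :: _ \<Rightarrow> 'u)
        (mcarrier (strong_dual (iterated_dual k X :: ('b, 'u) bimodule)))"
proof -
  obtain S :: "nat \<Rightarrow> 'u set" where S: "(UNIV :: 'c set) \<lesssim> S 0"
    "\<And>k. k < n \<Longrightarrow> (S k \<rightarrow>\<^sub>E (UNIV :: complex set)) \<lesssim> S (Suc k)"
    using room unfolding room_for_duals_def by blast
  have lep: "mcarrier (copy Y :: ('b, 'u) bimodule) \<lesssim> T"
    if "mcarrier Y \<lesssim> T" for Y :: "('b, 'x) bimodule" and T :: "'u set"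
    unfolding mcarrier_copy[OF inj_on_copy_map[OF that]]
    using image_lepoll that by (rule lepoll_trans)
  have lep': "mcarrier (copy Y :: ('b, 'u) bimodule) \<lesssim> T"
    if "mcarrier Y \<lesssim> T" for Y :: "('b, 'u \<Rightarrow> complex) bimodule" and T :: "'u set"
    unfolding mcarrier_copy[OF inj_on_copy_map[OF that]]
    using image_lepoll that by (rule lepoll_trans)
  have dual: "mcarrier (strong_dual Y) \<lesssim> (T \<rightarrow>\<^sub>E (UNIV :: complex set))"
    if Y: "mcarrier Y \<lesssim> T" for Y :: "('b, 'u) bimodule" and T :: "'u set"
  proof -
    obtain h where h: "inj_on h (mcarrier Y)" "h ` mcarrier Y \<subseteq> T"
      using Y unfolding lepoll_def by blast
    let ?g = "\<lambda>f. \<lambda>t\<in>T. f (inv_into (mcarrier Y) h t)"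
    have "inj_on ?g (continuous_functionals Y)"
    proof (rule inj_onI)
      fix f f'
      assume f: "f \<in> continuous_functionals Y" "f' \<in> continuous_functionals Y"
        and eq: "?g f = ?g f'"
      have "f x = f' x" if "x \<in> mcarrier Y" for x
        using fun_cong[OF eq, of "h x"] h that by (auto simp: image_subset_iff)
      then show "f = f'"
        using f unfolding continuous_functionals_def by (auto intro: extensionalityI)
    qed
    then show ?thesis
      unfolding mcarrier_strong_dual lepoll_def by (intro exI[of _ ?g]) auto
  qed
  have X0: "mcarrier X \<lesssim> S 0"
    using X S(1) by (rule lepoll_trans)
  then show "inj_on (copy_map X :: 'x \<Rightarrow> 'u) (mcarrier X)"
    by (rule inj_on_copy_map)
  have it: "k \<le> n \<Longrightarrow> mcarrier (iterated_dual k X :: ('b, 'u) bimodule) \<lesssim> S k" for k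
  proof (induction k)
    case 0
    then show ?case using lep[OF X0] by simp
  next
    case (Suc k)
    then have "mcarrier (strong_dual (iterated_dual k X :: ('b, 'u) bimodule)) \<lesssim> S (Suc k)"
      using dual S(2) by (meson Suc_leD Suc_le_lessD lepoll_trans)
    then show ?case using lep' by simp
  qed
  show "inj_on (copy_map (strong_dual (iterated_dual k X :: ('b, 'u) bimodule)) :: _ \<Rightarrow> 'u)
      (mcarrier (strong_dual (iterated_dual k X :: ('b, 'u) bimodule)))" if "k < n"
    by (rule inj_on_copy_map, rule lepoll_trans, rule dual, rule it) (use that S(2) in auto)
qed


section \<open>Derivations and ideal amenability\<close>

definition continuous_derivation ::
    "(nat \<Rightarrow> 'b::complex_algebra \<Rightarrow> real) \<Rightarrow> ('b, 'x) bimodule \<Rightarrow> ('b \<Rightarrow> 'x) \<Rightarrow> bool"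
  where "continuous_derivation p X D \<longleftrightarrow>
    continuous_map (seminorm_topology p) (mtop X) D \<and>
    (\<forall>a b. D (a + b) = madd X (D a) (D b)) \<and>
    (\<forall>c a. D (c *\<^sub>C a) = mscale X c (D a)) \<and>
    (\<forall>a b. D (a * b) = madd X (lact X a (D b)) (ract X (D a) b))"

definition inner_derivation :: "('b, 'x) bimodule \<Rightarrow> ('b \<Rightarrow> 'x) \<Rightarrow> bool"
  where "inner_derivation X D \<longleftrightarrow>
    (\<exists>x\<in>mcarrier X. \<forall>b. D b = madd X (lact X b x) (mscale X (-1) (ract X x b)))"

definition ideally_amenable ::
    "'u itself \<Rightarrow> nat \<Rightarrow> (nat \<Rightarrow> 'b::complex_algebra \<Rightarrow> real) \<Rightarrow> bool"
  where "ideally_amenable _ n p \<longleftrightarrow>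
    (\<forall>I D. closed_ideal p I \<and>
       continuous_derivation p (iterated_dual n (ideal_bimodule p I) :: ('b, 'u) bimodule) D \<longrightarrow>
       inner_derivation (iterated_dual n (ideal_bimodule p I) :: ('b, 'u) bimodule) D)"

end

theory Submission
  imports Defs
begin

text \<open>
  (i) A closed ideal \<open>I\<close> of \<open>A\<close> is also one of the unitization, the two \<open>n\<close>-th duals are isomorphic, and a
  derivation on \<open>A\<close> extends to the unitization by 0 on the identity.

  (ii) For a closed ideal \<open>J\<close> of the unitization, \<open>I = J \<inter> A\<close> has codimension at most one in \<open>J\<close>, and \<open>A\<close>
  acts trivially on \<open>J / I\<close>.  Hence the \<open>(2n-2)\<close>-nd dual \<open>X\<close> of \<open>J\<close> is the sum of that of \<open>I\<close>, called \<open>Y\<close>, and a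
  line spanned by \<open>j\<close>, with a trivial quotient; let \<open>\<psi>\<close> be the coordinate functional of \<open>j\<close>.  A derivation \<open>D\<close>
  into the dual of \<open>X\<close>, restricted to \<open>A\<close> and \<open>Y\<close>, is inner.  Extending the implementing functional to \<open>X\<close>
  and subtracting the inner derivation it defines leaves \<open>a \<mapsto> \<phi> a \<cdot> \<psi>\<close>, where \<open>\<phi>\<close> is continuous, because it is
  bounded on bounded sets, and vanishes on products.  Then \<open>\<phi> = 0\<close>: otherwise \<open>a \<mapsto> \<phi> a \<cdot> \<phi>''\<close>, with \<open>\<phi>''\<close> the
  canonical image of \<open>\<phi>\<close> in the \<open>(2n-1)\<close>-st dual of \<open>A\<close>, would be a derivation that is not inner, since an
  inner derivation at \<open>a\<close> vanishes on the canonical image of \<open>a\<close>, whereas the value here is \<open>\<phi> a * \<phi> a\<close>.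
\<close>

section \<open>Topologies given by seminorms\<close>

interpretation scaleC: module "scaleC :: complex \<Rightarrow> 'a::complex_algebra \<Rightarrow> 'a"
  by unfold_locales (simp_all add: scaleC_add_right scaleC_add_left scaleC_scaleC scaleC_one)

lemma continuous_map_euclideanI:
  fixes g :: "'t \<Rightarrow> 'm::metric_space"
  assumes "\<And>t e. t \<in> topspace T \<Longrightarrow> 0 < e \<Longrightarrow> \<exists>V. openin T V \<and> t \<in> V \<and> (\<forall>s\<in>V. dist (g s) (g t) < e)"
  shows "continuous_map T euclidean g"
  unfolding continuous_map_alt
proof (intro conjI allI impI)
  fix U :: "'m set" assume "openin euclidean U"
  then have U: "open U" by simp
  show "openin T (g -` U \<inter> topspace T)"
  proof (subst openin_subopen, intro ballI)
    fix t assume t: "t \<in> g -` U \<inter> topspace T"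
    then obtain e where e: "0 < e" "\<And>y. dist y (g t) < e \<Longrightarrow> y \<in> U"
      using U by (auto simp: open_dist)
    then obtain V where V: "openin T V" "t \<in> V" "\<forall>s\<in>V. dist (g s) (g t) < e"
      using assms[of t e] t by auto
    then show "\<exists>V. openin T V \<and> t \<in> V \<and> V \<subseteq> g -` U \<inter> topspace T"
      using e(2) openin_subset[OF V(1)] by blast
  qed
qed auto

text \<open>Set up as a locale because it is instantiated twice, with the seminorms \<open>p\<close>
  of the algebra and with those of its unitization.\<close>

locale seminormed_algebra =
  fixes p :: "nat \<Rightarrow> 'a::complex_algebra \<Rightarrow> real"
  assumes submult_seminorm: "submult_seminorm (p l)"
    and increasing: "p l x \<le> p (Suc l) x"
begin

lemma triangle: "p l (x + y) \<le> p l x + p l y"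
  and scale: "p l (c *\<^sub>C x) = cmod c * p l x"
  and submult: "p l (x * y) \<le> p l x * p l y"
  using submult_seminorm[of l] unfolding submult_seminorm_def by auto

lemma zero [simp]: "p l 0 = 0"
  using scale[of l 0 0] by simp

lemma uminus: "p l (- x) = p l x"
proof -
  have "- x = (-1) *\<^sub>C x" by (simp add: scaleC_one)
  then show ?thesis by (simp add: scale del: scaleC.scale_minus_left)
qed

lemma triangle_diff: "p l (x - y) \<le> p l x + p l y"
  using triangle[of l x "- y"] by (simp add: uminus)

lemma nonneg: "0 \<le> p l x"
  using triangle_diff[of l x x] by simp

lemma mono: "l \<le> m \<Longrightarrow> p l x \<le> p m x"
  by (induction rule: dec_induct) (auto intro: order_trans increasing)

lemma topspace [simp]: "topspace (seminorm_topology p) = UNIV"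
proof -
  have "x \<in> {y. p 0 (y - x) < 1}" for x by simp
  then show ?thesis
    unfolding seminorm_topology_def topology_generated_by_topspace
    by (intro equalityI subset_UNIV subsetI UnionI[of "{y. p 0 (y - _) < 1}"]) (blast intro: zero_less_one)+
qed

lemma openin_ball: "openin (seminorm_topology p) {y. p l (y - x) < r}"
proof (cases "0 < r")
  case True
  then show ?thesis
    unfolding seminorm_topology_def by (intro topology_generated_by_Basis) blast
next
  case False
  then have "{y. p l (y - x) < r} = {}"
    using nonneg[of l] by (smt (verit) empty_Collect_eq)
  then show ?thesis by simp
qed

text \<open>It suffices to pull back the generating balls. Around a point of such a preimage, the
  slack \<open>r - p l (g t - x)\<close> serves as the tolerance.\<close>

lemma continuous_map_into:
  assumes "\<And>t l e. t \<in> topspace T \<Longrightarrow> 0 < e \<Longrightarrow> \<exists>V. openin T V \<and> t \<in> V \<and> (\<forall>s\<in>V. p l (g s - g t) < e)"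
  shows "continuous_map T (seminorm_topology p) g"
  unfolding seminorm_topology_def
proof (rule continuous_on_generated_topo)
  fix U assume "U \<in> {{y. p l (y - x) < r} | l x r. 0 < r}"
  then obtain l x r where U: "U = {y. p l (y - x) < r}" by blast
  show "openin T (g -` U \<inter> topspace T)"
  proof (subst openin_subopen, intro ballI)
    fix t assume t: "t \<in> g -` U \<inter> topspace T"
    then have "0 < r - p l (g t - x)" by (simp add: U)
    then obtain V where V: "openin T V" "t \<in> V" "\<forall>s\<in>V. p l (g s - g t) < r - p l (g t - x)"
      using assms[of t "r - p l (g t - x)" l] t by auto
    have "p l (g s - x) < r" if "s \<in> V" for s
      using bspec[OF V(3) that] triangle[of l "g s - g t" "g t - x"] by simp
    then show "\<exists>V. openin T V \<and> t \<in> V \<and> V \<subseteq> g -` U \<inter> topspace T"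
      using V(1,2) openin_subset[OF V(1)] unfolding U by blast
  qed
next
  show "g ` topspace T \<subseteq> \<Union> {{y. p l (y - x) < r} | l x r. 0 < r}"
    using topspace unfolding seminorm_topology_def topology_generated_by_topspace by blast
qed

lemma continuous_map_scaleC: "continuous_map euclidean (seminorm_topology p) (\<lambda>c. c *\<^sub>C x)"
proof (rule continuous_map_into)
  fix c :: complex and l and e :: real assume e: "0 < e"
  \<comment> \<open>Adding 1 to the denominator keeps the radius meaningful when
    \<open>p l x = 0\<close>.\<close>
  let ?V = "ball c (e / (p l x + 1))"
  have "p l (d *\<^sub>C x - c *\<^sub>C x) < e" if "d \<in> ?V" for d
  proof -
    have "p l (d *\<^sub>C x - c *\<^sub>C x) = dist c d * p l x"
      by (simp add: scaleC.scale_left_diff_distrib[symmetric] scale dist_norm norm_minus_commute)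
    also have "\<dots> \<le> e / (p l x + 1) * p l x"
      using that nonneg[of l x] by (intro mult_right_mono) auto
    also have "\<dots> < e"
      using e nonneg[of l x] by (simp add: field_simps)
    finally show ?thesis .
  qed
  then show "\<exists>V. openin euclidean V \<and> c \<in> V \<and> (\<forall>d\<in>V. p l (d *\<^sub>C x - c *\<^sub>C x) < e)"
    using e nonneg[of l x] by (intro exI[of _ ?V]) auto
qed

lemma ball_neighbourhood:
  assumes "0 \<le> K" "0 < e"
  shows "\<exists>V. openin (seminorm_topology p) V \<and> t \<in> V \<and> (\<forall>s\<in>V. K * p l (s - t) < e)"
proof (intro exI conjI ballI)
  fix s assume "s \<in> {s. p l (s - t) < e / (K + 1)}"
  then have "p l (s - t) * (K + 1) < e"
    using assms by (simp add: pos_less_divide_eq)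
  then show "K * p l (s - t) < e"
    using nonneg[of l "s - t"] by (simp add: algebra_simps)
qed (use assms openin_ball in auto)

lemma continuous_map_functional:
  fixes g :: "'a \<Rightarrow> complex"
  assumes "\<And>x y. g (x - y) = g x - g y" and "\<And>x. cmod (g x) \<le> K * p l x"
  shows "continuous_map (seminorm_topology p) euclidean g"
proof (rule continuous_map_euclideanI)
  fix t and e :: real assume "0 < e"
  \<comment> \<open>\<open>K\<close> may be negative, whereas \<open>ball_neighbourhood\<close>
    expects a nonnegative factor.\<close>
  then obtain V where V: "openin (seminorm_topology p) V" "t \<in> V" "\<forall>s\<in>V. max K 0 * p l (s - t) < e"
    using ball_neighbourhood[of "max K 0" e t l] by auto
  have "dist (g s) (g t) < e" if "s \<in> V" for s
    using assms(2)[of "s - t"] V(3) that mult_right_mono[of K "max K 0" "p l (s - t)"] nonneg[of l "s - t"]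
    by (fastforce simp: dist_norm assms(1))
  then show "\<exists>V. openin (seminorm_topology p) V \<and> t \<in> V \<and> (\<forall>s\<in>V. dist (g s) (g t) < e)"
    using V by blast
qed

text \<open>Metrizable spaces are bornological: otherwise there are \<open>s l\<close> with \<open>p l (s l) \<le> 1\<close> and
  \<open>cmod (g (s l)) = l + 1\<close>, and by monotonicity of the seminorms the sequence \<open>s\<close> is bounded.\<close>

lemma continuous_map_functional_bounded:
  fixes g :: "'a \<Rightarrow> complex"
  assumes diff: "\<And>x y. g (x - y) = g x - g y" and scl: "\<And>c x. g (c *\<^sub>C x) = c * g x"
    and bdd: "\<And>S. (\<And>l. \<exists>M. \<forall>a\<in>S. p l a \<le> M) \<Longrightarrow> \<exists>M. \<forall>a\<in>S. cmod (g a) \<le> M"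
  shows "continuous_map (seminorm_topology p) euclidean g"
proof -
  have "\<exists>l. \<forall>x. cmod (g x) \<le> real (Suc l) * p l x"
  proof (rule ccontr)
    assume "\<not> ?thesis"
    then obtain u where u: "\<And>l. real (Suc l) * p l (u l) < cmod (g (u l))"
      by (metis not_le_imp_less)
    have gu: "0 < cmod (g (u l))" for l
      using u[of l] nonneg[of l "u l"] by (smt (verit) mult_nonneg_nonneg of_nat_0_le_iff)
    define s where "s l = complex_of_real (real (Suc l) / cmod (g (u l))) *\<^sub>C u l" for l
    have "p l (s l) \<le> 1" for l
      using u[of l] gu[of l] by (simp add: s_def scale norm_divide norm_mult field_simps del: of_nat_Suc)
    then have *: "p m (s l) \<le> 1" if "m \<le> l" for m l
      using mono[OF that] order_trans by blast
    have "\<exists>M. \<forall>a\<in>range s. p l a \<le> M" for l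
    proof (intro exI ballI)
      fix a assume "a \<in> range s"
      then obtain k where k: "a = s k" by blast
      \<comment> \<open>From index \<open>l\<close> on the values are at most 1; the finitely many
        earlier ones are bounded by their sum.\<close>
      show "p l a \<le> 1 + (\<Sum>i<l. p l (s i))"
      proof (cases "l \<le> k")
        case True
        then show ?thesis using *[OF True] k sum_nonneg[of "{..<l}" "\<lambda>i. p l (s i)"] nonneg by fastforce
      next
        case False
        then show ?thesis using member_le_sum[of k "{..<l}" "\<lambda>i. p l (s i)"] k nonneg by fastforce
      qed
    qed
    then obtain M where M: "\<forall>a\<in>range s. cmod (g a) \<le> M" using bdd by blast
    have "cmod (g (s l)) = real (Suc l)" for l
      using gu[of l] by (simp add: s_def scl norm_mult norm_divide del: of_nat_Suc)
    then have "real (Suc l) \<le> M" for l using M by (metis rangeI)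
    then show False using reals_Archimedean2[of M] by (meson lessI less_le_not_le of_nat_less_iff order_less_le_trans)
  qed
  then obtain l where "\<And>x. cmod (g x) \<le> real (Suc l) * p l x" by blast
  then show ?thesis by (rule continuous_map_functional[OF diff])
qed

end

lemma (in seminormed_algebra) continuous_map_linear:
  assumes "seminormed_algebra q"
    and "\<And>x y. g (x - y) = g x - g y" and "\<And>m. \<exists>K l. \<forall>x. q m (g x) \<le> K * p l x"
  shows "continuous_map (seminorm_topology p) (seminorm_topology q) g"
proof -
  interpret q: seminormed_algebra q by fact
  show ?thesis
  proof (rule q.continuous_map_into)
    fix t l and e :: real assume e: "0 < e"
    obtain K m where K: "\<forall>x. q l (g x) \<le> K * p m x" using assms(3) by blast
    obtain V where V: "openin (seminorm_topology p) V" "t \<in> V" "\<forall>s\<in>V. max K 0 * p m (s - t) < e"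
      using ball_neighbourhood[of "max K 0" e t m] e by auto
    have "q l (g s - g t) < e" if "s \<in> V" for s
    proof -
      have "q l (g s - g t) \<le> K * p m (s - t)" using K by (simp add: assms(2)[symmetric])
      also have "\<dots> \<le> max K 0 * p m (s - t)" using nonneg by (intro mult_right_mono) auto
      also have "\<dots> < e" using V(3) that by blast
      finally show ?thesis .
    qed
    then show "\<exists>V. openin (seminorm_topology p) V \<and> t \<in> V \<and> (\<forall>s\<in>V. q l (g s - g t) < e)"
      using V by blast
  qed
qed

section \<open>Seminorms of the unitization\<close>

lemma seminormed_algebra_unitization:
  assumes "seminormed_algebra p"
  shows "seminormed_algebra (unitization_seminorms p)"
proof -
  interpret seminormed_algebra p by fact
  show ?thesis
  proof
    fix l x
    show "unitization_seminorms p l x \<le> unitization_seminorms p (Suc l) x"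
      by (simp add: unitization_seminorms_def increasing)
    show "submult_seminorm (unitization_seminorms p l)"
      unfolding submult_seminorm_def
    proof (intro conjI allI)
      fix x y :: "'a unitization" and c
      let ?a = "algebra_part x" and ?b = "algebra_part y" and ?s = "scalar_part x" and ?t = "scalar_part y"
      show "unitization_seminorms p l (x + y) \<le> unitization_seminorms p l x + unitization_seminorms p l y"
        using triangle[of l ?a ?b] norm_triangle_ineq[of ?s ?t]
        by (simp add: unitization_seminorms_def plus_unitization_def)
      show "unitization_seminorms p l (c *\<^sub>C x) = cmod c * unitization_seminorms p l x"
        by (simp add: unitization_seminorms_def scaleC_unitization_def scale norm_mult algebra_simps)
      \<comment> \<open>Adding \<open>cmod ?s * cmod ?t\<close>, the contribution of the scalar
        part, completes this bound to the product of the two seminorm values.\<close>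
      have "p l (?a * ?b + ?t *\<^sub>C ?a + ?s *\<^sub>C ?b) \<le> p l ?a * p l ?b + cmod ?t * p l ?a + cmod ?s * p l ?b"
        using triangle[of l "?a * ?b + ?t *\<^sub>C ?a" "?s *\<^sub>C ?b"] triangle[of l "?a * ?b" "?t *\<^sub>C ?a"] submult[of l ?a ?b]
        by (simp add: scale)
      then show "unitization_seminorms p l (x * y) \<le> unitization_seminorms p l x * unitization_seminorms p l y"
        by (simp add: unitization_seminorms_def times_unitization_def norm_mult algebra_simps)
    qed
  qed
qed

section \<open>Topological bimodules and their strong duals\<close>

text \<open>Boundedness in the acting algebra, which is given by seminorms and not as a
  \<open>bimodule\<close>. On closed ideals it agrees with \<open>mbounded_in\<close>, see
  \<open>mbounded_in_ideal_iff\<close>.\<close>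

definition seminorm_bounded :: "(nat \<Rightarrow> 'a \<Rightarrow> real) \<Rightarrow> 'a set \<Rightarrow> bool"
  where "seminorm_bounded p S \<longleftrightarrow> (\<forall>l. \<exists>M. \<forall>a\<in>S. p l a \<le> M)"

text \<open>The acting types \<open>'b\<close> and \<open>'c\<close> may differ, since the maps
  compared later go between modules over the algebra and modules over its unitization.\<close>

definition continuous_linear :: "('b, 'x) bimodule \<Rightarrow> ('c, 'y) bimodule \<Rightarrow> ('x \<Rightarrow> 'y) \<Rightarrow> bool"
  where "continuous_linear X Y T \<longleftrightarrow>
    continuous_map (mtop X) (mtop Y) T \<and>
    (\<forall>x\<in>mcarrier X. \<forall>y\<in>mcarrier X. T (madd X x y) = madd Y (T x) (T y)) \<and>
    (\<forall>c. \<forall>x\<in>mcarrier X. T (mscale X c x) = mscale Y c (T x))"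

lemma continuous_linear_closed:
  "continuous_linear X Y T \<Longrightarrow> x \<in> mcarrier X \<Longrightarrow> T x \<in> mcarrier Y"
  unfolding continuous_linear_def continuous_map_def by blast

lemma continuous_linear_add:
  "continuous_linear X Y T \<Longrightarrow> x \<in> mcarrier X \<Longrightarrow> y \<in> mcarrier X \<Longrightarrow>
    T (madd X x y) = madd Y (T x) (T y)"
  unfolding continuous_linear_def by blast

lemma continuous_linear_scale:
  "continuous_linear X Y T \<Longrightarrow> x \<in> mcarrier X \<Longrightarrow> T (mscale X c x) = mscale Y c (T x)"
  unfolding continuous_linear_def by blast

lemma continuous_linear_compose:
  "continuous_linear X Y T \<Longrightarrow> continuous_linear Y Z T' \<Longrightarrow> continuous_linear X Z (\<lambda>x. T' (T x))"
  using continuous_linear_closed[of X Y T] continuous_map_compose[of "mtop X" "mtop Y" T "mtop Z" T']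
  unfolding continuous_linear_def by (simp add: o_def)

text \<open>Boundedness only requires hypocontinuous actions, which, unlike joint continuity, are
  inherited by strong duals.\<close>

locale topological_bimodule =
  fixes p :: "nat \<Rightarrow> 'b::complex_algebra \<Rightarrow> real" and X :: "('b, 'x) bimodule"
  assumes zero_closed: "mzero X \<in> mcarrier X"
    and add_closed: "\<lbrakk>x \<in> mcarrier X; y \<in> mcarrier X\<rbrakk> \<Longrightarrow> madd X x y \<in> mcarrier X"
    and add_assoc: "\<lbrakk>x \<in> mcarrier X; y \<in> mcarrier X; z \<in> mcarrier X\<rbrakk> \<Longrightarrow>
      madd X (madd X x y) z = madd X x (madd X y z)"
    and add_commute: "\<lbrakk>x \<in> mcarrier X; y \<in> mcarrier X\<rbrakk> \<Longrightarrow> madd X x y = madd X y x"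
    and scale_closed: "x \<in> mcarrier X \<Longrightarrow> mscale X c x \<in> mcarrier X"
    and scale_scale: "x \<in> mcarrier X \<Longrightarrow> mscale X c (mscale X d x) = mscale X (c * d) x"
    and scale_one: "x \<in> mcarrier X \<Longrightarrow> mscale X 1 x = x"
    and scale_zero: "x \<in> mcarrier X \<Longrightarrow> mscale X 0 x = mzero X"
    and continuous_scale: "x \<in> mcarrier X \<Longrightarrow> continuous_map euclidean (mtop X) (\<lambda>c. mscale X c x)"
    and linear_lact: "continuous_linear X X (lact X b)"
    and linear_ract: "continuous_linear X X (\<lambda>x. ract X x b)"
    and lact_plus: "x \<in> mcarrier X \<Longrightarrow> lact X (a + b) x = madd X (lact X a x) (lact X b x)"
    and lact_scaleC: "x \<in> mcarrier X \<Longrightarrow> lact X (c *\<^sub>C a) x = mscale X c (lact X a x)"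
    and lact_times: "x \<in> mcarrier X \<Longrightarrow> lact X (a * b) x = lact X a (lact X b x)"
    and ract_plus: "x \<in> mcarrier X \<Longrightarrow> ract X x (a + b) = madd X (ract X x a) (ract X x b)"
    and ract_scaleC: "x \<in> mcarrier X \<Longrightarrow> ract X x (c *\<^sub>C a) = mscale X c (ract X x a)"
    and ract_times: "x \<in> mcarrier X \<Longrightarrow> ract X x (a * b) = ract X (ract X x a) b"
    and lact_ract: "x \<in> mcarrier X \<Longrightarrow> lact X a (ract X x b) = ract X (lact X a x) b"
    and bounded_lact: "\<lbrakk>seminorm_bounded p S; mbounded_in X T\<rbrakk> \<Longrightarrow> mbounded_in X (\<Union>a\<in>S. lact X a ` T)"
    and bounded_ract: "\<lbrakk>seminorm_bounded p S; mbounded_in X T\<rbrakk> \<Longrightarrow> mbounded_in X (\<Union>a\<in>S. (\<lambda>x. ract X x a) ` T)"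
begin

lemma lact_closed: "x \<in> mcarrier X \<Longrightarrow> lact X b x \<in> mcarrier X"
  using continuous_linear_closed[OF linear_lact] .

lemma ract_closed: "x \<in> mcarrier X \<Longrightarrow> ract X x b \<in> mcarrier X"
  using continuous_linear_closed[OF linear_ract] .

end

lemma mbounded_in_image:
  assumes T: "continuous_linear X Y T" "T (mzero X) = mzero Y" and z: "mzero X \<in> mcarrier X"
    and S: "mbounded_in X S"
  shows "mbounded_in Y (T ` S)"
  unfolding mbounded_in_def
proof (intro conjI allI impI)
  show "T ` S \<subseteq> mcarrier Y"
    using S continuous_linear_closed[OF T(1)] unfolding mbounded_in_def by blast
  fix U assume U: "openin (mtop Y) U \<and> mzero Y \<in> U"
  define V where "V = {x \<in> mcarrier X. T x \<in> U}"
  have V: "openin (mtop X) V"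
    using T U unfolding V_def continuous_linear_def continuous_map_def by blast
  have "mzero X \<in> V" using T U z by (simp add: V_def)
  then obtain s where s: "s > 0" "\<And>t. t > s \<Longrightarrow> S \<subseteq> mscale X (complex_of_real t) ` V"
    using S V unfolding mbounded_in_def by blast
  have "T ` S \<subseteq> mscale Y (complex_of_real t) ` U" if t: "t > s" for t
  proof
    fix y assume "y \<in> T ` S"
    then obtain v where v: "v \<in> V" "y = T (mscale X (complex_of_real t) v)"
      using s(2)[OF t] by blast
    then have "y = mscale Y (complex_of_real t) (T v)"
      using continuous_linear_scale[OF T(1)] unfolding V_def by simp
    then show "y \<in> mscale Y (complex_of_real t) ` U"
      using v(1) unfolding V_def by blast
  qed
  then show "\<exists>s>0. \<forall>t>s. T ` S \<subseteq> mscale Y (complex_of_real t) ` U" using s(1) by blast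
qed

text \<open>Absorption passes from the generators to the whole topology: an intersection takes the
  larger of two thresholds, a union the threshold of a member containing \<open>z\<close>. In the
  applications \<open>h t\<close> is multiplication by \<open>1 / t\<close>.\<close>

lemma absorbs_generated:
  assumes "generate_topology_on \<S> U" "z \<in> U"
    and "\<And>V. \<lbrakk>V \<in> \<S>; z \<in> V\<rbrakk> \<Longrightarrow> \<exists>s>0. \<forall>t>s. \<forall>x\<in>B. h (t::real) x \<in> V"
  shows "\<exists>s>0. \<forall>t>s. \<forall>x\<in>B. h t x \<in> U"
  using assms(1,2)
proof induction
  case (Int a b)
  then obtain s s' where "s > 0" "s' > 0" "\<forall>t>s. \<forall>x\<in>B. h t x \<in> a" "\<forall>t>s'. \<forall>x\<in>B. h t x \<in> b"
    by auto
  then show ?case by (intro exI[of _ "max s s'"]) auto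
next
  case (UN K)
  then obtain k where k: "k \<in> K" "z \<in> k" by blast
  then obtain s where "s > 0" "\<forall>t>s. \<forall>x\<in>B. h t x \<in> k" using UN.IH by blast
  then show ?case using k(1) by blast
next
  case (Basis V)
  then show ?case using assms(3) by blast
qed simp

lemma functional_add:
  "\<lbrakk>f \<in> continuous_functionals X; x \<in> mcarrier X; y \<in> mcarrier X\<rbrakk> \<Longrightarrow> f (madd X x y) = f x + f y"
  unfolding continuous_functionals_def by blast

lemma functional_scale:
  "\<lbrakk>f \<in> continuous_functionals X; x \<in> mcarrier X\<rbrakk> \<Longrightarrow> f (mscale X c x) = c * f x"
  unfolding continuous_functionals_def by blast

lemma functional_continuous:
  "f \<in> continuous_functionals X \<Longrightarrow> continuous_map (mtop X) euclidean f"
  unfolding continuous_functionals_def by blast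

lemma functional_undefined:
  "\<lbrakk>f \<in> continuous_functionals X; x \<notin> mcarrier X\<rbrakk> \<Longrightarrow> f x = undefined"
  unfolding continuous_functionals_def by (blast intro: extensional_arb)

lemma functional_ext:
  assumes "f \<in> continuous_functionals X" "g \<in> continuous_functionals X" "\<And>x. x \<in> mcarrier X \<Longrightarrow> f x = g x"
  shows "f = g"
  using assms unfolding continuous_functionals_def by (auto intro: extensionalityI)

context topological_bimodule
begin

text \<open>For \<open>t > 0\<close>, multiplication by \<open>t\<close> is invertible on the
  carrier, with inverse multiplication by \<open>1 / t\<close>. Membership of a scaled point in
  \<open>U\<close> is easier to check than membership of the point in a scaled set.\<close>

lemma mbounded_in_iff:
  "mbounded_in X S \<longleftrightarrow> S \<subseteq> mcarrier X \<and>
    (\<forall>U. openin (mtop X) U \<and> mzero X \<in> U \<longrightarrow> (\<exists>s>0. \<forall>t>s. \<forall>x\<in>S. mscale X (complex_of_real (1 / t)) x \<in> U))"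
proof -
  have "x \<in> mscale X (complex_of_real t) ` U \<longleftrightarrow> mscale X (complex_of_real (1 / t)) x \<in> U"
    if "x \<in> mcarrier X" "openin (mtop X) U" "t > 0" for x U t
  proof
    assume "x \<in> mscale X (complex_of_real t) ` U"
    then obtain u where u: "u \<in> U" "x = mscale X (complex_of_real t) u" by blast
    have "u \<in> mcarrier X" using u(1) openin_subset[OF that(2)] by blast
    then have "mscale X (complex_of_real (1 / t)) x = u"
      using that(3) by (simp add: u(2) scale_scale scale_one)
    then show "mscale X (complex_of_real (1 / t)) x \<in> U" using u(1) by simp
  next
    assume "mscale X (complex_of_real (1 / t)) x \<in> U"
    moreover have "x = mscale X (complex_of_real t) (mscale X (complex_of_real (1 / t)) x)"
      using that by (simp add: scale_scale scale_one)
    ultimately show "x \<in> mscale X (complex_of_real t) ` U" by blast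
  qed
  then have "(\<exists>s>0. \<forall>t>s. S \<subseteq> mscale X (complex_of_real t) ` U) \<longleftrightarrow>
      (\<exists>s>0. \<forall>t>s. \<forall>x\<in>S. mscale X (complex_of_real (1 / t)) x \<in> U)"
    if "S \<subseteq> mcarrier X" "openin (mtop X) U" for U
    using that by (intro ex_cong1 conj_cong refl all_cong) (auto simp: subset_iff)
  then show ?thesis
    unfolding mbounded_in_def by (intro conj_cong refl all_cong1 imp_cong) simp_all
qed

text \<open>Scalar multiplication of the fixed vector \<open>x\<close> is continuous at 0, so all
  sufficiently small multiples of \<open>x\<close> lie in a given neighbourhood of zero.\<close>

lemma mbounded_in_singleton:
  assumes x: "x \<in> mcarrier X"
  shows "mbounded_in X {x}"
  unfolding mbounded_in_iff
proof (intro conjI allI impI)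
  fix U assume U: "openin (mtop X) U \<and> mzero X \<in> U"
  let ?W = "{c. mscale X c x \<in> U}"
  have "open ?W"
    using continuous_scale[OF x] U unfolding continuous_map_def by simp
  moreover have "0 \<in> ?W" using U x by (simp add: scale_zero)
  ultimately obtain e where e: "e > 0" "\<And>c. cmod c < e \<Longrightarrow> c \<in> ?W"
    by (auto simp: open_dist)
  have "mscale X (complex_of_real (1 / t)) x \<in> U" if "t > 1 / e" for t
  proof -
    have "t > 0" using that e(1) by (meson less_trans zero_less_divide_1_iff)
    then have "cmod (complex_of_real (1 / t)) < e"
      using that e(1) by (simp add: norm_divide field_simps)
    then show ?thesis using e(2) by blast
  qed
  then show "\<exists>s>0. \<forall>t>s. \<forall>y\<in>{x}. mscale X (complex_of_real (1 / t)) y \<in> U"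
    using e(1) by (intro exI[of _ "1 / e"]) auto
qed (use x in simp)

lemma functionalI:
  assumes "continuous_map (mtop X) euclidean g"
    and "\<And>x y. \<lbrakk>x \<in> mcarrier X; y \<in> mcarrier X\<rbrakk> \<Longrightarrow> g (madd X x y) = g x + g y"
    and "\<And>c x. x \<in> mcarrier X \<Longrightarrow> g (mscale X c x) = c * g x"
  shows "restrict g (mcarrier X) \<in> continuous_functionals X"
  using assms add_closed scale_closed
  unfolding continuous_functionals_def
  by (auto intro: continuous_map_eq)

lemma functional_zero:
  assumes "f \<in> continuous_functionals X"
  shows "f (mzero X) = 0"
proof -
  have "f (mscale X 0 (mzero X)) = 0 * f (mzero X)"
    using assms zero_closed unfolding continuous_functionals_def by blast
  then show ?thesis by (simp add: scale_zero zero_closed)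
qed

text \<open>The preimage of the unit disc is a neighbourhood of zero and absorbs \<open>S\<close>.
  The bound is \<open>s + 1\<close> because absorption is known only for factors strictly above
  \<open>s\<close>.\<close>

lemma functional_bounded:
  assumes f: "f \<in> continuous_functionals X" and S: "mbounded_in X S"
  shows "\<exists>M. \<forall>x\<in>S. cmod (f x) \<le> M"
proof -
  define U where "U = {x \<in> mcarrier X. f x \<in> ball 0 1}"
  have "openin (mtop X) U"
    using functional_continuous[OF f] unfolding U_def continuous_map_def
    by (meson open_ball open_openin)
  moreover have "mzero X \<in> U" using f zero_closed by (simp add: U_def functional_zero)
  ultimately obtain s where s: "s > 0" "\<forall>t>s. \<forall>x\<in>S. mscale X (complex_of_real (1 / t)) x \<in> U"
    using S unfolding mbounded_in_iff by blast
  have "cmod (f x) \<le> s + 1" if "x \<in> S" for x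
  proof -
    have x: "x \<in> mcarrier X" using that S unfolding mbounded_in_def by blast
    have "mscale X (complex_of_real (1 / (s + 1))) x \<in> U" using s(2) that by (meson less_add_one)
    then have "cmod (complex_of_real (1 / (s + 1)) * f x) < 1"
      using f x unfolding U_def continuous_functionals_def by simp
    then show ?thesis using s(1) by (simp add: norm_mult norm_divide del: of_real_add)
  qed
  then show ?thesis by blast
qed

end

section \<open>The strong topology and transposed maps\<close>

lemma strong_dual_simps:
  "mtop (strong_dual X) = strong_topology X"
  "mzero (strong_dual X) = (\<lambda>x\<in>mcarrier X. 0)"
  "madd (strong_dual X) f g = (\<lambda>x\<in>mcarrier X. f x + g x)"
  "mscale (strong_dual X) c f = (\<lambda>x\<in>mcarrier X. c * f x)"
  "lact (strong_dual X) b f = (\<lambda>x\<in>mcarrier X. f (ract X x b))"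
  "ract (strong_dual X) f b = (\<lambda>x\<in>mcarrier X. f (lact X b x))"
  by (simp_all add: strong_dual_def)

lemma topspace_strong_topology [simp]: "topspace (strong_topology X) = continuous_functionals X"
  using mcarrier_strong_dual[of X] by (simp add: strong_dual_simps)

lemma openin_strong_ball:
  assumes "f \<in> continuous_functionals X" "mbounded_in X S" "0 < r"
  shows "openin (strong_topology X) {g \<in> continuous_functionals X. \<exists>d<r. \<forall>x\<in>S. cmod (g x - f x) \<le> d}"
  unfolding strong_topology_def using assms by (intro topology_generated_by_Basis) blast

text \<open>A generating set asks for a deviation bound strictly below its radius \<open>r\<close>.
  If \<open>d < r\<close> is such a bound at \<open>t\<close>, a neighbourhood with tolerance
  \<open>(r - d) / 2\<close> keeps the total below \<open>r\<close>.\<close>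

lemma continuous_map_into_strong:
  assumes "g ` topspace T \<subseteq> continuous_functionals X"
    and "\<And>t S e. \<lbrakk>t \<in> topspace T; mbounded_in X S; 0 < e\<rbrakk> \<Longrightarrow>
      \<exists>V. openin T V \<and> t \<in> V \<and> (\<forall>s\<in>V. \<forall>x\<in>S. cmod (g s x - g t x) \<le> e)"
  shows "continuous_map T (strong_topology X) g"
  unfolding strong_topology_def
proof (rule continuous_on_generated_topo)
  show "g ` topspace T \<subseteq> \<Union> {{g \<in> continuous_functionals X. \<exists>d<r. \<forall>x\<in>S. cmod (g x - f x) \<le> d} | f S r.
       f \<in> continuous_functionals X \<and> mbounded_in X S \<and> 0 < r}"
    using assms(1) topspace_strong_topology[of X]
    unfolding strong_topology_def topology_generated_by_topspace by simp
next
  fix U assume "U \<in> {{g \<in> continuous_functionals X. \<exists>d<r. \<forall>x\<in>S. cmod (g x - f x) \<le> d} | f S r.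
       f \<in> continuous_functionals X \<and> mbounded_in X S \<and> 0 < r}"
  then obtain f S r where U: "U = {g \<in> continuous_functionals X. \<exists>d<r. \<forall>x\<in>S. cmod (g x - f x) \<le> d}"
    and S: "mbounded_in X S" by blast
  show "openin T (g -` U \<inter> topspace T)"
  proof (subst openin_subopen, intro ballI)
    fix t assume t: "t \<in> g -` U \<inter> topspace T"
    then obtain d where d: "d < r" "\<forall>x\<in>S. cmod (g t x - f x) \<le> d" unfolding U by blast
    obtain V where V: "openin T V" "t \<in> V" "\<forall>s\<in>V. \<forall>x\<in>S. cmod (g s x - g t x) \<le> (r - d) / 2"
      using assms(2)[of t S "(r - d) / 2"] t S d(1) by auto
    have "g s \<in> U" if "s \<in> V" for s
    proof -
      have "cmod (g s x - f x) \<le> (r - d) / 2 + d" if "x \<in> S" for x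
        using norm_triangle_le[of "g s x - g t x" "g t x - f x", OF add_mono]
          bspec[OF bspec[OF V(3) \<open>s \<in> V\<close>] that] bspec[OF d(2) that] by simp
      moreover have "(r - d) / 2 + d < r" using d(1) by argo
      moreover have "g s \<in> continuous_functionals X"
        using assms(1) openin_subset[OF V(1)] that by blast
      ultimately show ?thesis unfolding U by blast
    qed
    then show "\<exists>V. openin T V \<and> t \<in> V \<and> V \<subseteq> g -` U \<inter> topspace T"
      using V(1,2) openin_subset[OF V(1)] by blast
  qed
qed

text \<open>The transpose of \<open>T\<close>, cut off outside the carrier since functionals are
  extensional.\<close>

definition dual_map :: "('b, 'x) bimodule \<Rightarrow> ('x \<Rightarrow> 'y) \<Rightarrow> ('y \<Rightarrow> complex) \<Rightarrow> 'x \<Rightarrow> complex"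
  where "dual_map X T f = (\<lambda>x\<in>mcarrier X. f (T x))"

text \<open>Each action on the dual is the transpose of the opposite action, so its continuity and
  linearity are instances of facts about transposes.\<close>

lemma lact_strong_dual: "lact (strong_dual X) b = dual_map X (\<lambda>x. ract X x b)"
  and ract_strong_dual: "(\<lambda>f. ract (strong_dual X) f b) = dual_map X (lact X b)"
  by (simp_all add: fun_eq_iff dual_map_def strong_dual_simps)

lemma continuous_linear_zero:
  assumes "topological_bimodule p X" "topological_bimodule q Y" "continuous_linear X Y T"
  shows "T (mzero X) = mzero Y"
proof -
  interpret X: topological_bimodule p X by fact
  interpret Y: topological_bimodule q Y by fact
  have "T (mscale X 0 (mzero X)) = mscale Y 0 (T (mzero X))"
    by (rule continuous_linear_scale[OF assms(3) X.zero_closed])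
  then show ?thesis
    by (simp add: X.scale_zero Y.scale_zero X.zero_closed continuous_linear_closed[OF assms(3)])
qed

lemma dual_map_closed:
  assumes "topological_bimodule p X" "continuous_linear X Y T" "f \<in> continuous_functionals Y"
  shows "dual_map X T f \<in> continuous_functionals X"
proof -
  interpret topological_bimodule p X by fact
  have "continuous_map (mtop X) euclidean (f \<circ> T)"
    using assms(2,3) unfolding continuous_linear_def
    by (blast intro: continuous_map_compose functional_continuous)
  then show ?thesis
    unfolding dual_map_def using assms(2,3)
    by (intro functionalI)
      (simp_all add: o_def continuous_linear_add continuous_linear_scale continuous_linear_closed
        functional_add functional_scale)
qed

text \<open>\<open>T\<close> maps bounded sets to bounded sets, and functionals uniformly close on
  the image of \<open>S\<close> have transposes uniformly close on \<open>S\<close>.\<close>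

lemma continuous_linear_dual_map:
  assumes X: "topological_bimodule p X" and Y: "topological_bimodule q Y" and T: "continuous_linear X Y T"
  shows "continuous_linear (strong_dual Y) (strong_dual X) (dual_map X T)"
  unfolding continuous_linear_def
proof (intro conjI ballI allI)
  show "continuous_map (mtop (strong_dual Y)) (mtop (strong_dual X)) (dual_map X T)"
    unfolding strong_dual_simps
  proof (rule continuous_map_into_strong)
    show "dual_map X T ` topspace (strong_topology Y) \<subseteq> continuous_functionals X"
      using dual_map_closed[OF X T] by auto
    fix f S and e :: real
    assume f: "f \<in> topspace (strong_topology Y)" and S: "mbounded_in X S" and e: "0 < e"
    have *: "mbounded_in Y (T ` S)"
      by (rule mbounded_in_image[OF T continuous_linear_zero[OF X Y T] topological_bimodule.zero_closed[OF X] S])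
    define V where "V = {g \<in> continuous_functionals Y. \<exists>d<e. \<forall>x\<in>T ` S. cmod (g x - f x) \<le> d}"
    have "openin (strong_topology Y) V"
      unfolding V_def using f * e by (intro openin_strong_ball) auto
    moreover have "f \<in> V" using f e unfolding V_def by auto
    moreover have "cmod (dual_map X T g x - dual_map X T f x) \<le> e" if "g \<in> V" "x \<in> S" for g x
    proof -
      have "x \<in> mcarrier X" using S that(2) unfolding mbounded_in_def by blast
      moreover have "cmod (g (T x) - f (T x)) \<le> e" using that unfolding V_def by fastforce
      ultimately show ?thesis by (simp add: dual_map_def)
    qed
    ultimately show "\<exists>V. openin (strong_topology Y) V \<and> f \<in> V \<and>
        (\<forall>g\<in>V. \<forall>x\<in>S. cmod (dual_map X T g x - dual_map X T f x) \<le> e)"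
      by blast
  qed
qed (auto simp: dual_map_def strong_dual_simps continuous_linear_closed[OF T])

section \<open>Bounded sets and module structure of the strong dual\<close>

context topological_bimodule
begin

lemma strong_dual_zero_closed: "(\<lambda>x\<in>mcarrier X. 0) \<in> continuous_functionals X"
  by (rule functionalI) auto

lemma strong_dual_scale_closed:
  assumes "f \<in> continuous_functionals X"
  shows "(\<lambda>x\<in>mcarrier X. c * f x) \<in> continuous_functionals X"
proof (rule functionalI)
  show "continuous_map (mtop X) euclidean (\<lambda>x. c * f x)"
    using continuous_map_compose[OF functional_continuous[OF assms], of euclidean "\<lambda>z. c * z"]
    by (simp add: o_def continuous_on_mult_left)
qed (simp_all add: functional_add[OF assms] functional_scale[OF assms] algebra_simps)

lemma strong_dual_add_closed:
  assumes f: "f \<in> continuous_functionals X" and g: "g \<in> continuous_functionals X"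
  shows "(\<lambda>x\<in>mcarrier X. f x + g x) \<in> continuous_functionals X"
  by (rule functionalI)
    (simp_all add: functional_add[OF f] functional_add[OF g] functional_scale[OF f] functional_scale[OF g]
      continuous_map_add functional_continuous[OF f] functional_continuous[OF g] algebra_simps)

text \<open>In one direction \<open>B\<close> is absorbed by the unit ball of \<open>S\<close> about
  zero. In the other, absorption is checked on the generating sets only, by
  \<open>absorbs_generated\<close>.\<close>

lemma mbounded_in_strong_dual_iff:
  "mbounded_in (strong_dual X) B \<longleftrightarrow> B \<subseteq> continuous_functionals X \<and>
    (\<forall>S. mbounded_in X S \<longrightarrow> (\<exists>M. \<forall>f\<in>B. \<forall>x\<in>S. cmod (f x) \<le> M))" (is "_ \<longleftrightarrow> ?sub \<and> ?bdd")
proof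
  assume B: "mbounded_in (strong_dual X) B"
  then have sub: ?sub unfolding mbounded_in_def by (simp add: mcarrier_strong_dual)
  have "\<exists>M. \<forall>f\<in>B. \<forall>x\<in>S. cmod (f x) \<le> M" if S: "mbounded_in X S" for S
  proof -
    let ?z = "\<lambda>x\<in>mcarrier X. 0 :: complex"
    define U where "U = {g \<in> continuous_functionals X. \<exists>d<1. \<forall>x\<in>S. cmod (g x - ?z x) \<le> d}"
    have SX: "S \<subseteq> mcarrier X" using S unfolding mbounded_in_def by blast
    have "openin (strong_topology X) U"
      unfolding U_def by (intro openin_strong_ball strong_dual_zero_closed S) simp
    moreover have "?z \<in> U" unfolding U_def using strong_dual_zero_closed by (auto intro: exI[of _ 0])
    ultimately obtain s where s: "s > 0" "\<forall>t>s. B \<subseteq> mscale (strong_dual X) (complex_of_real t) ` U"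
      using B unfolding mbounded_in_def strong_dual_simps by blast
    have "cmod (f x) \<le> s + 1" if "f \<in> B" "x \<in> S" for f x
    proof -
      obtain u where u: "u \<in> U" "f = mscale (strong_dual X) (complex_of_real (s + 1)) u"
        using s(2) \<open>f \<in> B\<close> less_add_one[of s] by blast
      have "cmod (u x) \<le> 1" using u(1) \<open>x \<in> S\<close> SX unfolding U_def by fastforce
      then show ?thesis
        using u(2) s(1) \<open>x \<in> S\<close> SX mult_left_mono[of "cmod (u x)" 1 "s + 1"]
        by (auto simp: strong_dual_simps norm_mult simp del: of_real_add)
    qed
    then show ?thesis by blast
  qed
  then show "?sub \<and> ?bdd" using sub by blast
next
  assume B: "?sub \<and> ?bdd"
  let ?h = "\<lambda>t. mscale (strong_dual X) (complex_of_real (1 / t))"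
  have "\<exists>s>0. \<forall>t>s. B \<subseteq> mscale (strong_dual X) (complex_of_real t) ` U"
    if U: "openin (strong_topology X) U" "(\<lambda>x\<in>mcarrier X. 0) \<in> U" for U
  proof -
    have "\<exists>s>0. \<forall>t>s. \<forall>f\<in>B. ?h t f \<in> U"
    proof (rule absorbs_generated[OF openin_topology_generated_by])
      show "openin (topology_generated_by {{g \<in> continuous_functionals X. \<exists>d<r. \<forall>x\<in>S. cmod (g x - f x) \<le> d} | f S r.
         f \<in> continuous_functionals X \<and> mbounded_in X S \<and> 0 < r}) U"
        using U(1) unfolding strong_topology_def .
      show "(\<lambda>x\<in>mcarrier X. 0) \<in> U" by fact
      fix V assume "V \<in> {{g \<in> continuous_functionals X. \<exists>d<r. \<forall>x\<in>S. cmod (g x - f x) \<le> d} | f S r.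
         f \<in> continuous_functionals X \<and> mbounded_in X S \<and> 0 < r}" and z: "(\<lambda>x\<in>mcarrier X. 0) \<in> V"
      then obtain f S r where V: "V = {g \<in> continuous_functionals X. \<exists>d<r. \<forall>x\<in>S. cmod (g x - f x) \<le> d}"
        and S: "mbounded_in X S" by blast
      have SX: "S \<subseteq> mcarrier X" using S unfolding mbounded_in_def by blast
      obtain d where d: "d < r" "\<forall>x\<in>S. cmod (f x) \<le> d" using z SX unfolding V by fastforce
      obtain M where M: "\<forall>g\<in>B. \<forall>x\<in>S. cmod (g x) \<le> M" using B S by blast
      \<comment> \<open>The ball \<open>V\<close> contains zero but is centred at \<open>f\<close>,
        whose size on \<open>S\<close> is at most \<open>d\<close>. Beyond this threshold, division
        by \<open>t\<close> brings the values of \<open>g\<close> on \<open>S\<close> below half of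
        the slack \<open>r - d\<close>.\<close>
      define s where "s = 2 * (\<bar>M\<bar> + 1) / (r - d)"
      have "s > 0" using d(1) by (simp add: s_def)
      moreover have "?h t g \<in> V" if t: "t > s" and g: "g \<in> B" for t g
      proof -
        have t0: "t > 0" using t \<open>s > 0\<close> by simp
        have "cmod (?h t g x - f x) \<le> (r - d) / 2 + d" if x: "x \<in> S" for x
        proof -
          have "\<bar>M\<bar> \<le> (r - d) / 2 * t" using t d(1) by (simp add: s_def field_simps)
          moreover have "cmod (g x) \<le> \<bar>M\<bar>" using M g x by fastforce
          ultimately have "cmod (g x) / t \<le> (r - d) / 2" using t0 by (simp add: divide_le_eq)
          moreover have "?h t g x = complex_of_real (1 / t) * g x"
            using x SX by (auto simp: strong_dual_simps)
          ultimately have "cmod (?h t g x) \<le> (r - d) / 2"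
            using t0 by (simp add: norm_mult norm_divide)
          then show ?thesis
            using bspec[OF d(2) x] norm_triangle_ineq4[of "?h t g x" "f x"] by linarith
        qed
        moreover have "(r - d) / 2 + d < r" using d(1) by argo
        moreover have "?h t g \<in> continuous_functionals X"
          unfolding strong_dual_simps using strong_dual_scale_closed B g by blast
        ultimately show ?thesis unfolding V by blast
      qed
      ultimately show "\<exists>s>0. \<forall>t>s. \<forall>g\<in>B. ?h t g \<in> V" by blast
    qed
    then obtain s where s: "s > 0" "\<forall>t>s. \<forall>f\<in>B. ?h t f \<in> U" by blast
    have "f = mscale (strong_dual X) (complex_of_real t) (?h t f)" if "f \<in> B" "t > s" for f t
    proof (rule functional_ext)
      show "f \<in> continuous_functionals X" using B that by blast
      then show "mscale (strong_dual X) (complex_of_real t) (?h t f) \<in> continuous_functionals X"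
        unfolding strong_dual_simps by (intro strong_dual_scale_closed)
    qed (use that s(1) in \<open>simp add: strong_dual_simps\<close>)
    then show ?thesis using s by (intro exI[of _ s]) blast
  qed
  then show "mbounded_in (strong_dual X) B"
    using B unfolding mbounded_in_def mcarrier_strong_dual by (simp add: strong_dual_simps)
qed

text \<open>Singletons are bounded, so strong convergence implies pointwise convergence.\<close>

lemma continuous_map_evaluation:
  assumes "x \<in> mcarrier X"
  shows "continuous_map (strong_topology X) euclidean (\<lambda>f. f x)"
proof (rule continuous_map_euclideanI)
  fix f and e :: real assume f: "f \<in> topspace (strong_topology X)" and e: "0 < e"
  let ?V = "{g \<in> continuous_functionals X. \<exists>d<e. \<forall>y\<in>{x}. cmod (g y - f y) \<le> d}"
  have "openin (strong_topology X) ?V"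
    using f e by (intro openin_strong_ball mbounded_in_singleton assms) auto
  moreover have "f \<in> ?V" using f e by auto
  moreover have "\<forall>g\<in>?V. dist (g x) (f x) < e" by (auto simp: dist_norm)
  ultimately show "\<exists>V. openin (strong_topology X) V \<and> f \<in> V \<and> (\<forall>g\<in>V. dist (g x) (f x) < e)"
    by blast
qed

end

text \<open>The two sides are exchanged: the values of \<open>lact a f\<close> on a bounded
  \<open>T\<close> are the values of \<open>f\<close> on the set of all \<open>ract x a\<close>.
  Letting \<open>a\<close> range over a bounded set keeps this set bounded, which is exactly the
  axiom for the other side, and so the axioms reproduce themselves.\<close>

lemma (in topological_bimodule) topological_bimodule_strong_dual:
  "topological_bimodule p (strong_dual X)"
proof
  note closed = add_closed scale_closed lact_closed ract_closed
  show "continuous_linear (strong_dual X) (strong_dual X) (lact (strong_dual X) b)" for b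
    unfolding lact_strong_dual using continuous_linear_dual_map[OF topological_bimodule_axioms topological_bimodule_axioms linear_ract] .
  show "continuous_linear (strong_dual X) (strong_dual X) (\<lambda>f. ract (strong_dual X) f b)" for b
    unfolding ract_strong_dual using continuous_linear_dual_map[OF topological_bimodule_axioms topological_bimodule_axioms linear_lact] .
  show "continuous_map euclidean (mtop (strong_dual X)) (\<lambda>c. mscale (strong_dual X) c f)"
    if f: "f \<in> mcarrier (strong_dual X)" for f
    unfolding strong_dual_simps
  proof (rule continuous_map_into_strong)
    have fX: "f \<in> continuous_functionals X" using f by (simp add: mcarrier_strong_dual)
    then show "(\<lambda>c. \<lambda>x\<in>mcarrier X. c * f x) ` topspace euclidean \<subseteq> continuous_functionals X"
      using strong_dual_scale_closed by auto
    fix c :: complex and S and e :: real assume S: "mbounded_in X S" and e: "0 < e"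
    obtain M where M: "\<forall>x\<in>S. cmod (f x) \<le> M" using functional_bounded[OF fX S] by blast
    have "cmod ((\<lambda>x\<in>mcarrier X. d * f x) x - (\<lambda>x\<in>mcarrier X. c * f x) x) \<le> e"
      if d: "d \<in> ball c (e / (\<bar>M\<bar> + 1))" and x: "x \<in> S" for d x
    proof -
      have "x \<in> mcarrier X" using x S unfolding mbounded_in_def by blast
      moreover have "cmod (d * f x - c * f x) = dist c d * cmod (f x)"
        by (simp add: left_diff_distrib[symmetric] norm_mult dist_norm norm_minus_commute)
      moreover have "dist c d * cmod (f x) \<le> e / (\<bar>M\<bar> + 1) * (\<bar>M\<bar> + 1)"
        using d bspec[OF M x] e by (intro mult_mono) auto
      ultimately show ?thesis using e by simp
    qed
    then show "\<exists>V. openin euclidean V \<and> c \<in> V \<and>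
        (\<forall>d\<in>V. \<forall>x\<in>S. cmod ((\<lambda>x\<in>mcarrier X. d * f x) x - (\<lambda>x\<in>mcarrier X. c * f x) x) \<le> e)"
      using e by (intro exI[of _ "ball c (e / (\<bar>M\<bar> + 1))"]) auto
  qed
  fix S B assume S: "seminorm_bounded p S" and B: "mbounded_in (strong_dual X) B"
  have sub: "B \<subseteq> continuous_functionals X" using B by (simp add: mbounded_in_strong_dual_iff)
  show "mbounded_in (strong_dual X) (\<Union>a\<in>S. lact (strong_dual X) a ` B)"
    unfolding mbounded_in_strong_dual_iff
  proof (intro conjI allI impI)
    show "(\<Union>a\<in>S. lact (strong_dual X) a ` B) \<subseteq> continuous_functionals X"
      using dual_map_closed[OF topological_bimodule_axioms linear_ract] sub
      by (auto simp: strong_dual_simps dual_map_def)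
    fix T assume T: "mbounded_in X T"
    then have TX: "T \<subseteq> mcarrier X" unfolding mbounded_in_def by blast
    obtain M where "\<forall>f\<in>B. \<forall>x\<in>(\<Union>a\<in>S. (\<lambda>x. ract X x a) ` T). cmod (f x) \<le> M"
      using B bounded_ract[OF S T] unfolding mbounded_in_strong_dual_iff by blast
    then show "\<exists>M. \<forall>f\<in>\<Union>a\<in>S. lact (strong_dual X) a ` B. \<forall>x\<in>T. cmod (f x) \<le> M"
      using TX by (intro exI[of _ M]) (auto simp: strong_dual_simps)
  qed
  show "mbounded_in (strong_dual X) (\<Union>a\<in>S. (\<lambda>f. ract (strong_dual X) f a) ` B)"
    unfolding mbounded_in_strong_dual_iff
  proof (intro conjI allI impI)
    show "(\<Union>a\<in>S. (\<lambda>f. ract (strong_dual X) f a) ` B) \<subseteq> continuous_functionals X"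
      using dual_map_closed[OF topological_bimodule_axioms linear_lact] sub
      by (auto simp: strong_dual_simps dual_map_def)
    fix T assume T: "mbounded_in X T"
    then have TX: "T \<subseteq> mcarrier X" unfolding mbounded_in_def by blast
    obtain M where "\<forall>f\<in>B. \<forall>x\<in>(\<Union>a\<in>S. lact X a ` T). cmod (f x) \<le> M"
      using B bounded_lact[OF S T] unfolding mbounded_in_strong_dual_iff by blast
    then show "\<exists>M. \<forall>f\<in>\<Union>a\<in>S. (\<lambda>f. ract (strong_dual X) f a) ` B. \<forall>x\<in>T. cmod (f x) \<le> M"
      using TX by (intro exI[of _ M]) (auto simp: strong_dual_simps)
  qed
qed (auto simp: strong_dual_simps mcarrier_strong_dual functional_undefined
    strong_dual_zero_closed[unfolded restrict_def] strong_dual_add_closed[unfolded restrict_def]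
    strong_dual_scale_closed[unfolded restrict_def]
    lact_closed ract_closed functional_add functional_scale algebra_simps fun_eq_iff restrict_def
    lact_plus lact_scaleC lact_times ract_plus ract_scaleC ract_times lact_ract
    dest: functional_zero)

text \<open>The canonical image of \<open>x\<close> in the second dual.\<close>

lemma (in topological_bimodule) evaluation_functional:
  assumes x: "x \<in> mcarrier X"
  shows "(\<lambda>f\<in>continuous_functionals X. f x) \<in> continuous_functionals (strong_dual X)"
proof -
  interpret dual: topological_bimodule p "strong_dual X"
    by (rule topological_bimodule_strong_dual)
  have "restrict (\<lambda>f. f x) (mcarrier (strong_dual X)) \<in> continuous_functionals (strong_dual X)"
    by (rule dual.functionalI) (simp_all add: strong_dual_simps continuous_map_evaluation x)
  then show ?thesis by (simp add: mcarrier_strong_dual)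
qed

section \<open>Isomorphic copies and equivariant maps\<close>

text \<open>Equivariance over two algebras at once: \<open>\<alpha>\<close> and \<open>\<beta>\<close> map an index algebra to those acting
  on \<open>X\<close> and \<open>Y\<close>.\<close>

definition equivariant ::
    "('c \<Rightarrow> 'a) \<Rightarrow> ('c \<Rightarrow> 'b) \<Rightarrow> ('a, 'x) bimodule \<Rightarrow> ('b, 'y) bimodule \<Rightarrow> ('x \<Rightarrow> 'y) \<Rightarrow> bool"
  where "equivariant \<alpha> \<beta> X Y T \<longleftrightarrow>
    (\<forall>a. \<forall>x\<in>mcarrier X. T (lact X (\<alpha> a) x) = lact Y (\<beta> a) (T x) \<and>
       T (ract X x (\<alpha> a)) = ract Y (T x) (\<beta> a))"

lemma equivariant_lact:
  "equivariant \<alpha> \<beta> X Y T \<Longrightarrow> x \<in> mcarrier X \<Longrightarrow> T (lact X (\<alpha> a) x) = lact Y (\<beta> a) (T x)"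
  and equivariant_ract:
  "equivariant \<alpha> \<beta> X Y T \<Longrightarrow> x \<in> mcarrier X \<Longrightarrow> T (ract X x (\<alpha> a)) = ract Y (T x) (\<beta> a)"
  unfolding equivariant_def by auto

lemma equivariant_compose:
  assumes "equivariant \<alpha> \<beta> X Y T" "equivariant \<beta> \<gamma> Y Z T'" "continuous_linear X Y T"
  shows "equivariant \<alpha> \<gamma> X Z (\<lambda>x. T' (T x))"
  using assms continuous_linear_closed[OF assms(3)] unfolding equivariant_def by metis

lemma equivariant_dual_map:
  assumes X: "topological_bimodule p X" and Y: "topological_bimodule q Y"
    and T: "continuous_linear X Y T" "equivariant \<alpha> \<beta> X Y T"
  shows "equivariant \<beta> \<alpha> (strong_dual Y) (strong_dual X) (dual_map X T)"
proof -
  interpret X: topological_bimodule p X by fact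
  interpret Y: topological_bimodule q Y by fact
  show ?thesis
    unfolding equivariant_def
    by (auto simp: fun_eq_iff dual_map_def strong_dual_simps X.lact_closed X.ract_closed
        continuous_linear_closed[OF T(1)] equivariant_lact[OF T(2)] equivariant_ract[OF T(2)])
qed

text \<open>\<open>to_copy\<close> is a parameter although it equals \<open>copy_map X\<close>: the
  target type \<open>'u\<close> does not occur in \<open>X\<close>, and the parameter fixes
  it.\<close>

locale copied_bimodule = topological_bimodule p X
  for p :: "nat \<Rightarrow> 'b::complex_algebra \<Rightarrow> real" and X :: "('b, 'x) bimodule" +
  fixes to_copy :: "'x \<Rightarrow> 'u"
  assumes to_copy: "to_copy = copy_map X"
    and inj: "inj_on to_copy (mcarrier X)"
begin

abbreviation from_copy :: "'u \<Rightarrow> 'x" where "from_copy \<equiv> copy_inv X"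
abbreviation X' :: "('b, 'u) bimodule" where "X' \<equiv> copy X"

lemma mcarrier_X': "mcarrier X' = to_copy ` mcarrier X"
  using mcarrier_copy inj unfolding to_copy .

lemma to_copy_closed: "x \<in> mcarrier X \<Longrightarrow> to_copy x \<in> mcarrier X'"
  by (simp add: mcarrier_X')

lemma from_copy_closed: "y \<in> mcarrier X' \<Longrightarrow> from_copy y \<in> mcarrier X"
  unfolding mcarrier_X' copy_inv_def to_copy by (rule inv_into_into)

lemma from_to_copy: "x \<in> mcarrier X \<Longrightarrow> from_copy (to_copy x) = x"
  using inj by (simp add: copy_inv_def to_copy)

lemma to_from_copy: "y \<in> mcarrier X' \<Longrightarrow> to_copy (from_copy y) = y"
  unfolding mcarrier_X' copy_inv_def to_copy by (rule f_inv_into_f)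

lemma copy_simps:
  "mzero X' = to_copy (mzero X)"
  "madd X' y z = to_copy (madd X (from_copy y) (from_copy z))"
  "mscale X' c y = to_copy (mscale X c (from_copy y))"
  "lact X' b y = to_copy (lact X b (from_copy y))"
  "ract X' y b = to_copy (ract X (from_copy y) b)"
  by (simp_all add: copy_def to_copy)

lemma mtop_copy: "mtop X' = pullback_topology (to_copy ` mcarrier X) from_copy (mtop X)"
  by (simp add: copy_def to_copy)

lemma continuous_linear_from_copy: "continuous_linear X' X from_copy"
  unfolding continuous_linear_def
proof (intro conjI)
  show "continuous_map (mtop X') (mtop X) from_copy"
    unfolding mtop_copy using continuous_map_pullback[OF continuous_map_id] by (simp add: o_def)
qed (auto simp: copy_simps from_copy_closed from_to_copy add_closed scale_closed)

lemma continuous_linear_to_copy: "continuous_linear X X' to_copy"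
  unfolding continuous_linear_def
proof (intro conjI)
  have "continuous_map (mtop X) (mtop X) (from_copy \<circ> to_copy)"
    by (rule continuous_map_eq[OF continuous_map_id]) (simp add: from_to_copy)
  then show "continuous_map (mtop X) (mtop X') to_copy"
    unfolding mtop_copy by (rule continuous_map_pullback') blast
qed (auto simp: copy_simps from_to_copy)

lemma equivariant_from_copy: "equivariant \<alpha> \<alpha> X' X from_copy"
  unfolding equivariant_def by (simp add: copy_simps from_copy_closed from_to_copy lact_closed ract_closed)

lemma equivariant_to_copy: "equivariant \<alpha> \<alpha> X X' to_copy"
  unfolding equivariant_def by (simp add: copy_simps from_to_copy)

lemma mbounded_in_copy:
  assumes "mbounded_in X' S"
  shows "mbounded_in X (from_copy ` S)"
  using continuous_linear_from_copy _ _ assms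
  by (rule mbounded_in_image) (simp_all add: copy_simps from_to_copy zero_closed to_copy_closed)

lemma mbounded_in_to_copy:
  assumes "mbounded_in X S"
  shows "mbounded_in X' (to_copy ` S)"
  using continuous_linear_to_copy _ zero_closed assms
  by (rule mbounded_in_image) (simp add: copy_simps)

lemma topological_bimodule_copy: "topological_bimodule p X'"
proof
  show "madd X' y z = madd X' z y" if "y \<in> mcarrier X'" "z \<in> mcarrier X'" for y z
    using that by (simp add: copy_simps from_copy_closed add_commute)
  show "continuous_linear X' X' (lact X' b)" for b
    using continuous_linear_compose[OF continuous_linear_compose[OF continuous_linear_from_copy linear_lact]
        continuous_linear_to_copy]
    by (simp add: copy_simps[abs_def])
  show "continuous_linear X' X' (\<lambda>x. ract X' x b)" for b
    using continuous_linear_compose[OF continuous_linear_compose[OF continuous_linear_from_copy linear_ract]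
        continuous_linear_to_copy]
    by (simp add: copy_simps[abs_def])
  show "continuous_map euclidean (mtop X') (\<lambda>c. mscale X' c y)" if "y \<in> mcarrier X'" for y
    using continuous_map_compose[OF continuous_scale[OF from_copy_closed[OF that]], of "mtop X'" to_copy]
      continuous_linear_to_copy
    unfolding continuous_linear_def by (simp add: copy_simps o_def)
  fix S T assume S: "seminorm_bounded p S" and T: "mbounded_in X' T"
  have "(\<Union>a\<in>S. lact X' a ` T) = to_copy ` (\<Union>a\<in>S. lact X a ` from_copy ` T)"
    by (auto simp: copy_simps)
  then show "mbounded_in X' (\<Union>a\<in>S. lact X' a ` T)"
    using mbounded_in_to_copy bounded_lact[OF S mbounded_in_copy[OF T]] by simp
  have "(\<Union>a\<in>S. (\<lambda>x. ract X' x a) ` T) = to_copy ` (\<Union>a\<in>S. (\<lambda>x. ract X x a) ` from_copy ` T)"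
    by (auto simp: copy_simps)
  then show "mbounded_in X' (\<Union>a\<in>S. (\<lambda>x. ract X' x a) ` T)"
    using mbounded_in_to_copy bounded_ract[OF S mbounded_in_copy[OF T]] by simp
qed (simp_all add: copy_simps to_copy_closed from_copy_closed from_to_copy to_from_copy zero_closed
    add_closed add_assoc scale_closed scale_scale scale_one scale_zero lact_closed ract_closed
    lact_plus lact_scaleC lact_times ract_plus ract_scaleC ract_times lact_ract)

lemma functional_copy:
  "\<psi> \<in> continuous_functionals X \<Longrightarrow> dual_map X' from_copy \<psi> \<in> continuous_functionals X'"
  using topological_bimodule_copy continuous_linear_from_copy by (rule dual_map_closed)

end

section \<open>One-dimensional extensions\<close>

text \<open>The vector \<open>j\<close> may be zero.  With \<open>sub\<close>, \<open>Y\<close> is a submodule and the quotient by it a trivial module;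
  with \<open>quot\<close>, \<open>Y\<close> is a quotient module and the kernel a trivial module.  Dualising exchanges the two
  situations.\<close>

definition line_extension ::
    "bool \<Rightarrow> bool \<Rightarrow> ('a \<Rightarrow> 'b) \<Rightarrow> ('b, 'x) bimodule \<Rightarrow> ('a, 'y) bimodule \<Rightarrow> bool"
  where "line_extension sub quot \<theta> X Y \<longleftrightarrow>
    (\<exists>\<iota> \<rho> \<psi> j. continuous_linear Y X \<iota> \<and> continuous_linear X Y \<rho> \<and>
       \<psi> \<in> continuous_functionals X \<and> j \<in> mcarrier X \<and>
       (\<forall>y\<in>mcarrier Y. \<rho> (\<iota> y) = y) \<and>
       (\<forall>x\<in>mcarrier X. madd X (\<iota> (\<rho> x)) (mscale X (\<psi> x) j) = x) \<and>
       (sub \<longrightarrow> equivariant id \<theta> Y X \<iota> \<and>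
          (\<forall>a. \<forall>x\<in>mcarrier X. \<psi> (lact X (\<theta> a) x) = 0 \<and> \<psi> (ract X x (\<theta> a)) = 0)) \<and>
       (quot \<longrightarrow> equivariant \<theta> id X Y \<rho> \<and>
          (\<forall>a. lact X (\<theta> a) j = mzero X \<and> ract X j (\<theta> a) = mzero X)))"

text \<open>Transposition exchanges \<open>\<iota>\<close> with \<open>\<rho>\<close>, and
  \<open>\<psi>\<close> with \<open>j\<close>: \<open>\<psi>\<close> becomes the vector spanning the
  line and evaluation at \<open>j\<close> its coordinate. That \<open>\<psi>\<close> kills all
  products then says that the actions kill the new vector, and conversely.\<close>

lemma line_extension_strong_dual:
  assumes X: "topological_bimodule q X" and Y: "topological_bimodule p Y"
    and ext: "line_extension sub quot \<theta> X Y"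
  shows "line_extension quot sub \<theta> (strong_dual X) (strong_dual Y)"
proof -
  interpret X: topological_bimodule q X by fact
  interpret Y: topological_bimodule p Y by fact
  obtain \<iota> \<rho> \<psi> j where \<iota>: "continuous_linear Y X \<iota>" and \<rho>: "continuous_linear X Y \<rho>"
    and \<psi>: "\<psi> \<in> continuous_functionals X" and j: "j \<in> mcarrier X"
    and inv: "\<And>y. y \<in> mcarrier Y \<Longrightarrow> \<rho> (\<iota> y) = y"
    and dec: "\<And>x. x \<in> mcarrier X \<Longrightarrow> madd X (\<iota> (\<rho> x)) (mscale X (\<psi> x) j) = x"
    and sub: "sub \<Longrightarrow> equivariant id \<theta> Y X \<iota>"
      "\<And>a x. sub \<Longrightarrow> x \<in> mcarrier X \<Longrightarrow> \<psi> (lact X (\<theta> a) x) = 0 \<and> \<psi> (ract X x (\<theta> a)) = 0"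
    and quot: "quot \<Longrightarrow> equivariant \<theta> id X Y \<rho>"
      "\<And>a. quot \<Longrightarrow> lact X (\<theta> a) j = mzero X \<and> ract X j (\<theta> a) = mzero X"
    using ext unfolding line_extension_def by metis
  note closed = continuous_linear_closed[OF \<iota>] continuous_linear_closed[OF \<rho>]
  let ?j = "\<lambda>f\<in>continuous_functionals X. f j"
  have "dual_map Y \<iota> (dual_map X \<rho> g) = g" if "g \<in> continuous_functionals Y" for g
    using that by (auto simp: fun_eq_iff dual_map_def closed inv functional_undefined)
  moreover have "madd (strong_dual X) (dual_map X \<rho> (dual_map Y \<iota> f)) (mscale (strong_dual X) (?j f) \<psi>) = f"
    if f: "f \<in> continuous_functionals X" for f
  proof
    fix x
    show "madd (strong_dual X) (dual_map X \<rho> (dual_map Y \<iota> f)) (mscale (strong_dual X) (?j f) \<psi>) x = f x"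
    proof (cases "x \<in> mcarrier X")
      case True
      have "f x = f (madd X (\<iota> (\<rho> x)) (mscale X (\<psi> x) j))" using dec[OF True] by simp
      also have "\<dots> = f (\<iota> (\<rho> x)) + \<psi> x * f j"
        using f True j by (simp add: functional_add functional_scale closed X.scale_closed)
      finally show ?thesis using f True by (simp add: strong_dual_simps dual_map_def closed)
    qed (simp add: strong_dual_simps functional_undefined[OF f])
  qed
  moreover have "?j (lact (strong_dual X) (\<theta> a) f) = 0 \<and> ?j (ract (strong_dual X) f (\<theta> a)) = 0"
    if "quot" and f: "f \<in> continuous_functionals X" for a f
  proof -
    have "lact (strong_dual X) (\<theta> a) f \<in> continuous_functionals X"
      unfolding lact_strong_dual by (rule dual_map_closed[OF X X.linear_ract f])
    moreover have "ract (strong_dual X) f (\<theta> a) \<in> continuous_functionals X"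
      using dual_map_closed[OF X X.linear_lact f] by (simp add: strong_dual_simps dual_map_def)
    ultimately show ?thesis
      using quot(2)[OF that(1), of a] j f by (simp add: strong_dual_simps X.functional_zero)
  qed
  moreover have "lact (strong_dual X) (\<theta> a) \<psi> = mzero (strong_dual X) \<and>
      ract (strong_dual X) \<psi> (\<theta> a) = mzero (strong_dual X)" if "sub" for a
    using sub(2)[OF that] by (auto simp: strong_dual_simps fun_eq_iff restrict_def)
  ultimately show ?thesis
    unfolding line_extension_def mcarrier_strong_dual
    using continuous_linear_dual_map[OF X Y \<rho>] continuous_linear_dual_map[OF Y X \<iota>]
      X.evaluation_functional[OF j] \<psi> equivariant_dual_map[OF X Y \<rho> quot(1)]
      equivariant_dual_map[OF Y X \<iota> sub(1)]
    by (intro exI[of _ "dual_map X \<rho>"] exI[of _ "dual_map Y \<iota>"] exI[of _ ?j] exI[of _ \<psi>]) blast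
qed

lemma line_extension_copy:
  assumes X: "copied_bimodule q X (c :: 'x \<Rightarrow> 'u)" and Y: "copied_bimodule p Y (d :: 'y \<Rightarrow> 'v)"
    and ext: "line_extension sub quot \<theta> X Y"
  shows "line_extension sub quot \<theta> (copy X :: (_, 'u) bimodule) (copy Y :: (_, 'v) bimodule)"
proof -
  interpret X: copied_bimodule q X c by fact
  interpret Y: copied_bimodule p Y d by fact
  obtain \<iota> \<rho> \<psi> j where \<iota>: "continuous_linear Y X \<iota>" and \<rho>: "continuous_linear X Y \<rho>"
    and \<psi>: "\<psi> \<in> continuous_functionals X" and j: "j \<in> mcarrier X"
    and inv: "\<And>y. y \<in> mcarrier Y \<Longrightarrow> \<rho> (\<iota> y) = y"
    and dec: "\<And>x. x \<in> mcarrier X \<Longrightarrow> madd X (\<iota> (\<rho> x)) (mscale X (\<psi> x) j) = x"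
    and sub: "sub \<Longrightarrow> equivariant id \<theta> Y X \<iota>"
      "\<And>a x. sub \<Longrightarrow> x \<in> mcarrier X \<Longrightarrow> \<psi> (lact X (\<theta> a) x) = 0 \<and> \<psi> (ract X x (\<theta> a)) = 0"
    and quot: "quot \<Longrightarrow> equivariant \<theta> id X Y \<rho>"
      "\<And>a. quot \<Longrightarrow> lact X (\<theta> a) j = mzero X \<and> ract X j (\<theta> a) = mzero X"
    using ext unfolding line_extension_def by metis
  note closed = continuous_linear_closed[OF \<iota>] continuous_linear_closed[OF \<rho>]
    X.to_copy_closed X.from_copy_closed Y.to_copy_closed Y.from_copy_closed
    X.lact_closed X.ract_closed X.scale_closed j
  note inverse = X.from_to_copy X.to_from_copy Y.from_to_copy Y.to_from_copy
  let ?\<iota> = "\<lambda>y. c (\<iota> (Y.from_copy y))" and ?\<rho> = "\<lambda>x. d (\<rho> (X.from_copy x))"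
  have "continuous_linear Y.X' X.X' ?\<iota>" "continuous_linear X.X' Y.X' ?\<rho>"
    by (intro continuous_linear_compose[OF continuous_linear_compose, OF Y.continuous_linear_from_copy \<iota> X.continuous_linear_to_copy]
        continuous_linear_compose[OF continuous_linear_compose, OF X.continuous_linear_from_copy \<rho> Y.continuous_linear_to_copy])+
  moreover have "equivariant id \<theta> Y.X' X.X' ?\<iota>" if "sub"
    by (intro equivariant_compose[OF equivariant_compose[OF Y.equivariant_from_copy sub(1)[OF that]] X.equivariant_to_copy]
        Y.continuous_linear_from_copy continuous_linear_compose[OF Y.continuous_linear_from_copy \<iota>])
  moreover have "equivariant \<theta> id X.X' Y.X' ?\<rho>" if "quot"
    by (intro equivariant_compose[OF equivariant_compose[OF X.equivariant_from_copy quot(1)[OF that]] Y.equivariant_to_copy]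
        X.continuous_linear_from_copy continuous_linear_compose[OF X.continuous_linear_from_copy \<rho>])
  moreover have "dual_map X.X' X.from_copy \<psi> (lact X.X' (\<theta> a) x) = 0 \<and>
      dual_map X.X' X.from_copy \<psi> (ract X.X' x (\<theta> a)) = 0" if "sub" "x \<in> mcarrier X.X'" for a x
    using sub(2)[OF that(1)] that(2) by (simp add: dual_map_def X.copy_simps closed inverse)
  moreover have "lact X.X' (\<theta> a) (c j) = mzero X.X' \<and> ract X.X' (c j) (\<theta> a) = mzero X.X'"
    if "quot" for a
    using quot(2)[OF that] by (simp add: X.copy_simps inverse j)
  moreover have "?\<rho> (?\<iota> y) = y" if "y \<in> mcarrier Y.X'" for y
    using that by (simp add: inverse closed inv)
  moreover have "madd X.X' (?\<iota> (?\<rho> x)) (mscale X.X' (dual_map X.X' X.from_copy \<psi> x) (c j)) = x"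
    if "x \<in> mcarrier X.X'" for x
    using that dec[OF X.from_copy_closed[OF that]] by (simp add: dual_map_def X.copy_simps inverse closed)
  ultimately show ?thesis
    unfolding line_extension_def
    using X.functional_copy[OF \<psi>] X.to_copy_closed[OF j]
    by (intro exI[of _ ?\<iota>] exI[of _ ?\<rho>] exI[of _ "dual_map X.X' X.from_copy \<psi>"] exI[of _ "c j"]) blast
qed

section \<open>Functionals vanishing on products\<close>

text \<open>The functional \<open>\<phi>\<close> on the algebra and the identity map extend along the canonical embeddings
  into the even duals, as \<open>\<psi>\<close> and the assignment of \<open>x\<close> to \<open>a\<close>; only the properties below matter.\<close>

definition extends_to_functional :: "('b \<Rightarrow> complex) \<Rightarrow> ('b, 'x) bimodule \<Rightarrow> bool"
  where "extends_to_functional \<phi> X \<longleftrightarrow>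
    (\<exists>\<psi>\<in>continuous_functionals X.
       (\<forall>b. \<forall>x\<in>mcarrier X. \<psi> (lact X b x) = 0 \<and> \<psi> (ract X x b) = 0) \<and>
       (\<forall>a. \<exists>x\<in>mcarrier X. lact X a x = ract X x a \<and> \<psi> x = \<phi> a))"

definition extends_to_vector :: "('b \<Rightarrow> complex) \<Rightarrow> ('b, 'x) bimodule \<Rightarrow> bool"
  where "extends_to_vector \<phi> X \<longleftrightarrow>
    (\<exists>x\<in>mcarrier X.
       (\<forall>b. lact X b x = mzero X \<and> ract X x b = mzero X) \<and>
       (\<forall>a. \<exists>\<psi>\<in>continuous_functionals X. (\<forall>y\<in>mcarrier X. \<psi> (lact X a y) = \<psi> (ract X y a)) \<and> \<psi> x = \<phi> a))"

context topological_bimodule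
begin

text \<open>The vector is \<open>\<psi>\<close> itself, annihilated by both actions because it kills
  all products. If \<open>x\<close> is assigned to \<open>a\<close>, evaluation at \<open>x\<close>
  is the functional required for \<open>a\<close>: it takes equal values on
  \<open>a \<cdot> f\<close> and \<open>f \<cdot> a\<close> since \<open>x\<close> commutes with
  \<open>a\<close>.\<close>

lemma extends_to_vector_strong_dual:
  assumes "extends_to_functional \<phi> X"
  shows "extends_to_vector \<phi> (strong_dual X)"
proof -
  interpret dual: topological_bimodule p "strong_dual X"
    by (rule topological_bimodule_strong_dual)
  note closed = dual.lact_closed[unfolded mcarrier_strong_dual] dual.ract_closed[unfolded mcarrier_strong_dual]
  obtain \<psi> where \<psi>: "\<psi> \<in> continuous_functionals X"
    "\<And>b x. x \<in> mcarrier X \<Longrightarrow> \<psi> (lact X b x) = 0 \<and> \<psi> (ract X x b) = 0"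
    "\<And>a. \<exists>x\<in>mcarrier X. lact X a x = ract X x a \<and> \<psi> x = \<phi> a"
    using assms unfolding extends_to_functional_def by blast
  have "\<exists>\<eta>\<in>continuous_functionals (strong_dual X).
      (\<forall>f\<in>mcarrier (strong_dual X). \<eta> (lact (strong_dual X) a f) = \<eta> (ract (strong_dual X) f a)) \<and> \<eta> \<psi> = \<phi> a" for a
  proof -
    obtain x where x: "x \<in> mcarrier X" "lact X a x = ract X x a" "\<psi> x = \<phi> a" using \<psi>(3) by blast
    have "lact (strong_dual X) a f x = ract (strong_dual X) f a x" for f
      using x by (simp add: strong_dual_simps)
    then show ?thesis
      using evaluation_functional[OF x(1)] x(3) \<psi>(1)
      by (intro bexI[of _ "\<lambda>f\<in>continuous_functionals X. f x"]) (auto simp: mcarrier_strong_dual closed)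
  qed
  then show ?thesis
    unfolding extends_to_vector_def using \<psi>(1,2)
    by (intro bexI[of _ \<psi>]) (auto simp: mcarrier_strong_dual strong_dual_simps fun_eq_iff)
qed

text \<open>The functional is evaluation at the given vector \<open>x\<close>, and the functional
  assigned to \<open>a\<close> becomes the element that commutes with \<open>a\<close>.\<close>

lemma extends_to_functional_strong_dual:
  assumes "extends_to_vector \<phi> X"
  shows "extends_to_functional \<phi> (strong_dual X)"
proof -
  interpret dual: topological_bimodule p "strong_dual X"
    by (rule topological_bimodule_strong_dual)
  note closed = dual.lact_closed[unfolded mcarrier_strong_dual] dual.ract_closed[unfolded mcarrier_strong_dual]
  obtain x where x: "x \<in> mcarrier X" "\<And>b. lact X b x = mzero X \<and> ract X x b = mzero X"
    "\<And>a. \<exists>\<psi>\<in>continuous_functionals X. (\<forall>y\<in>mcarrier X. \<psi> (lact X a y) = \<psi> (ract X y a)) \<and> \<psi> x = \<phi> a"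
    using assms unfolding extends_to_vector_def by blast
  have "\<exists>f\<in>mcarrier (strong_dual X). lact (strong_dual X) a f = ract (strong_dual X) f a \<and>
      (\<lambda>f\<in>continuous_functionals X. f x) f = \<phi> a" for a
  proof -
    obtain \<psi> where "\<psi> \<in> continuous_functionals X"
      "\<forall>y\<in>mcarrier X. \<psi> (lact X a y) = \<psi> (ract X y a)" "\<psi> x = \<phi> a"
      using x(3) by blast
    then show ?thesis
      by (intro bexI[of _ \<psi>]) (simp_all add: mcarrier_strong_dual strong_dual_simps fun_eq_iff)
  qed
  then show ?thesis
    unfolding extends_to_functional_def using evaluation_functional[OF x(1)] x(1,2)
    by (intro bexI[of _ "\<lambda>f\<in>continuous_functionals X. f x"])
      (auto simp: mcarrier_strong_dual closed[unfolded strong_dual_simps] strong_dual_simps functional_zero)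
qed

end

context copied_bimodule
begin

lemma extends_to_functional_copy:
  assumes "extends_to_functional \<phi> X"
  shows "extends_to_functional \<phi> X'"
proof -
  obtain \<psi> where \<psi>: "\<psi> \<in> continuous_functionals X"
    "\<And>b x. x \<in> mcarrier X \<Longrightarrow> \<psi> (lact X b x) = 0 \<and> \<psi> (ract X x b) = 0"
    "\<And>a. \<exists>x\<in>mcarrier X. lact X a x = ract X x a \<and> \<psi> x = \<phi> a"
    using assms unfolding extends_to_functional_def by blast
  have "\<exists>y\<in>mcarrier X'. lact X' a y = ract X' y a \<and> dual_map X' from_copy \<psi> y = \<phi> a" for a
    using \<psi>(3)[of a] by (force simp: copy_simps dual_map_def from_to_copy mcarrier_X')
  then show ?thesis
    unfolding extends_to_functional_def using functional_copy[OF \<psi>(1)] \<psi>(2)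
    by (intro bexI[of _ "dual_map X' from_copy \<psi>"])
      (simp_all add: copy_simps dual_map_def from_to_copy to_copy_closed from_copy_closed lact_closed ract_closed)
qed

lemma extends_to_vector_copy:
  assumes "extends_to_vector \<phi> X"
  shows "extends_to_vector \<phi> X'"
proof -
  obtain x where x: "x \<in> mcarrier X" "\<And>b. lact X b x = mzero X \<and> ract X x b = mzero X"
    "\<And>a. \<exists>\<psi>\<in>continuous_functionals X. (\<forall>y\<in>mcarrier X. \<psi> (lact X a y) = \<psi> (ract X y a)) \<and> \<psi> x = \<phi> a"
    using assms unfolding extends_to_vector_def by blast
  have "\<exists>\<psi>\<in>continuous_functionals X'.
      (\<forall>y\<in>mcarrier X'. \<psi> (lact X' a y) = \<psi> (ract X' y a)) \<and> \<psi> (to_copy x) = \<phi> a" for a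
  proof -
    obtain \<psi> where \<psi>: "\<psi> \<in> continuous_functionals X"
      "\<forall>y\<in>mcarrier X. \<psi> (lact X a y) = \<psi> (ract X y a)" "\<psi> x = \<phi> a"
      using x(3) by blast
    then show ?thesis
      using functional_copy[OF \<psi>(1)] x(1)
      by (intro bexI[of _ "dual_map X' from_copy \<psi>"])
        (simp_all add: copy_simps dual_map_def from_to_copy to_copy_closed from_copy_closed lact_closed ract_closed)
  qed
  then show ?thesis
    unfolding extends_to_vector_def using x(1,2)
    by (intro bexI[of _ "to_copy x"]) (simp_all add: copy_simps from_to_copy to_copy_closed)
qed

end

section \<open>Closed ideals\<close>

lemma ideal_bimodule_simps:
  "mtop (ideal_bimodule p I) = subtopology (seminorm_topology p) I"
  "mzero (ideal_bimodule p I) = 0"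
  "madd (ideal_bimodule p I) = (+)"
  "mscale (ideal_bimodule p I) = scaleC"
  "lact (ideal_bimodule p I) = (*)"
  "ract (ideal_bimodule p I) = (*)"
  by (simp_all add: ideal_bimodule_def)

lemma closed_ideal_simps:
  assumes "closed_ideal p I"
  shows "0 \<in> I" "\<lbrakk>x \<in> I; y \<in> I\<rbrakk> \<Longrightarrow> x + y \<in> I" "x \<in> I \<Longrightarrow> c *\<^sub>C x \<in> I" "\<lbrakk>x \<in> I; y \<in> I\<rbrakk> \<Longrightarrow> x - y \<in> I"
    "x \<in> I \<Longrightarrow> a * x \<in> I" "x \<in> I \<Longrightarrow> x * a \<in> I"
  using assms scaleC.subspace_diff unfolding closed_ideal_def scaleC.subspace_def by auto

context seminormed_algebra
begin

lemma mcarrier_ideal: "mcarrier (ideal_bimodule p I) = I"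
  by (simp add: ideal_bimodule_simps)

text \<open>Balls about zero give the seminorm bounds; conversely these bounds yield absorption by
  each generating ball that contains zero.\<close>

lemma mbounded_in_ideal_iff:
  assumes I: "closed_ideal p I"
  shows "mbounded_in (ideal_bimodule p I) S \<longleftrightarrow> S \<subseteq> I \<and> seminorm_bounded p S"
proof
  assume S: "mbounded_in (ideal_bimodule p I) S"
  have "\<exists>M. \<forall>x\<in>S. p l x \<le> M" for l
  proof -
    let ?U = "{y. p l (y - 0) < 1} \<inter> I"
    have "openin (mtop (ideal_bimodule p I)) ?U"
      unfolding ideal_bimodule_simps using openin_ball by (rule openin_subtopology_Int)
    moreover have "mzero (ideal_bimodule p I) \<in> ?U"
      by (simp add: ideal_bimodule_simps closed_ideal_simps[OF I])
    ultimately obtain s where s: "s > 0" "\<forall>t>s. S \<subseteq> mscale (ideal_bimodule p I) (complex_of_real t) ` ?U"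
      using S unfolding mbounded_in_def by blast
    have "p l x \<le> s + 1" if x: "x \<in> S" for x
    proof -
      obtain u where u: "u \<in> ?U" "x = complex_of_real (s + 1) *\<^sub>C u"
        using s(2) x less_add_one[of s] unfolding ideal_bimodule_simps by blast
      then show ?thesis
        using s(1) mult_left_mono[of "p l u" 1 "s + 1"] by (simp add: scale del: of_real_add)
    qed
    then show ?thesis by blast
  qed
  moreover have "S \<subseteq> I" using S by (simp add: mbounded_in_def mcarrier_ideal)
  ultimately show "S \<subseteq> I \<and> seminorm_bounded p S" unfolding seminorm_bounded_def by blast
next
  assume S: "S \<subseteq> I \<and> seminorm_bounded p S"
  have "\<exists>s>0. \<forall>t>s. S \<subseteq> scaleC (complex_of_real t) ` U"
    if U: "openin (subtopology (seminorm_topology p) I) U" "0 \<in> U" for U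
  proof -
    obtain V where V: "openin (seminorm_topology p) V" "U = V \<inter> I"
      using U(1) by (auto simp: openin_subtopology)
    have "\<exists>s>0. \<forall>t>s. \<forall>x\<in>S. complex_of_real (1 / t) *\<^sub>C x \<in> V"
    proof (rule absorbs_generated[OF openin_topology_generated_by])
      show "openin (topology_generated_by {{y. p l (y - x) < r} | l x r. 0 < r}) V"
        using V(1) unfolding seminorm_topology_def .
      show "0 \<in> V" using U(2) V(2) by blast
      fix W assume "W \<in> {{y. p l (y - x) < r} | l x r. 0 < r}" and W0: "0 \<in> W"
      then obtain l x0 r where W: "W = {y. p l (y - x0) < r}" by blast
      \<comment> \<open>The generating ball has an arbitrary centre \<open>x0\<close>; by the
        triangle inequality it contains the ball of radius \<open>r - p l x0\<close> about
        zero.\<close>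
      have d: "0 < r - p l x0" using W0 by (simp add: W uminus)
      obtain M where M: "\<forall>x\<in>S. p l x \<le> M" using S unfolding seminorm_bounded_def by blast
      have "complex_of_real (1 / t) *\<^sub>C x \<in> W" if t: "t > (\<bar>M\<bar> + 1) / (r - p l x0)" and x: "x \<in> S" for t x
      proof -
        have "0 < (\<bar>M\<bar> + 1) / (r - p l x0)" using d by simp
        then have t0: "0 < t" using t by linarith
        have "p l x \<le> M" using M x by blast
        moreover have "\<bar>M\<bar> + 1 < t * (r - p l x0)" using t d by (simp add: pos_divide_less_eq)
        ultimately have "p l x < (r - p l x0) * t" by (simp add: mult.commute)
        then have "p l (complex_of_real (1 / t) *\<^sub>C x) < r - p l x0"
          using t0 by (simp add: scale norm_divide pos_divide_less_eq)
        then show ?thesis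
          using triangle_diff[of l "complex_of_real (1 / t) *\<^sub>C x" x0] by (simp add: W)
      qed
      then show "\<exists>s>0. \<forall>t>s. \<forall>x\<in>S. complex_of_real (1 / t) *\<^sub>C x \<in> W"
        using d by (intro exI[of _ "(\<bar>M\<bar> + 1) / (r - p l x0)"]) auto
    qed
    then obtain s where s: "s > 0" "\<forall>t>s. \<forall>x\<in>S. complex_of_real (1 / t) *\<^sub>C x \<in> V" by blast
    have "S \<subseteq> scaleC (complex_of_real t) ` U" if t: "t > s" for t
    proof
      fix x assume x: "x \<in> S"
      have "complex_of_real (1 / t) *\<^sub>C x \<in> U"
        using s(2) t x S V(2) closed_ideal_simps(3)[OF I] by blast
      moreover have "x = complex_of_real t *\<^sub>C complex_of_real (1 / t) *\<^sub>C x"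
        using s(1) t by (simp add: scaleC_scaleC scaleC_one)
      ultimately show "x \<in> scaleC (complex_of_real t) ` U" by blast
    qed
    then show ?thesis using s(1) by blast
  qed
  then show "mbounded_in (ideal_bimodule p I) S"
    using S by (simp add: mbounded_in_def mcarrier_ideal) (simp add: ideal_bimodule_simps)
qed

text \<open>Submultiplicativity gives both the continuity of each multiplication and the boundedness
  of the set of products of two bounded sets.\<close>

lemma topological_bimodule_ideal:
  assumes I: "closed_ideal p I"
  shows "topological_bimodule p (ideal_bimodule p I)"
proof
  have sub: "continuous_map (subtopology (seminorm_topology p) I) (subtopology (seminorm_topology p) I) g"
    if "continuous_map (seminorm_topology p) (seminorm_topology p) g" "\<And>x. x \<in> I \<Longrightarrow> g x \<in> I" for g
    using that by (auto simp: continuous_map_in_subtopology intro: continuous_map_from_subtopology)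
  have "continuous_map (seminorm_topology p) (seminorm_topology p) ((*) b)" for b
  proof (rule continuous_map_linear)
    show "\<exists>K l. \<forall>x. p m (b * x) \<le> K * p l x" for m using submult by blast
  qed (simp_all add: seminormed_algebra_axioms algebra_simps)
  then show "continuous_linear (ideal_bimodule p I) (ideal_bimodule p I) (lact (ideal_bimodule p I) b)" for b
    using sub closed_ideal_simps[OF I]
    by (simp add: continuous_linear_def ideal_bimodule_simps distrib_left mult_scaleC_right)
  have "continuous_map (seminorm_topology p) (seminorm_topology p) (\<lambda>x. x * b)" for b
  proof (rule continuous_map_linear)
    show "\<exists>K l. \<forall>x. p m (x * b) \<le> K * p l x" for m using submult by (metis mult.commute)
  qed (simp_all add: seminormed_algebra_axioms algebra_simps)
  then show "continuous_linear (ideal_bimodule p I) (ideal_bimodule p I) (\<lambda>x. ract (ideal_bimodule p I) x b)" for b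
    using sub closed_ideal_simps[OF I]
    by (simp add: continuous_linear_def ideal_bimodule_simps distrib_right mult_scaleC_left)
  show "continuous_map euclidean (mtop (ideal_bimodule p I)) (\<lambda>c. mscale (ideal_bimodule p I) c x)"
    if "x \<in> mcarrier (ideal_bimodule p I)" for x
    using that continuous_map_scaleC closed_ideal_simps(3)[OF I]
    by (auto simp: ideal_bimodule_simps continuous_map_in_subtopology)
  fix S T assume S: "seminorm_bounded p S" and T: "mbounded_in (ideal_bimodule p I) T"
  have prod: "\<exists>M. \<forall>a\<in>S. \<forall>x\<in>T. p l a * p l x \<le> M" for l
  proof -
    obtain M N where "\<forall>a\<in>S. p l a \<le> M" "\<forall>x\<in>T. p l x \<le> N"
      using S T unfolding mbounded_in_ideal_iff[OF I] seminorm_bounded_def by metis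
    then have "\<forall>a\<in>S. \<forall>x\<in>T. p l a * p l x \<le> M * N"
      using nonneg[of l] by (meson mult_mono order_trans)
    then show ?thesis by blast
  qed
  have TI: "T \<subseteq> I" using T by (simp add: mbounded_in_ideal_iff[OF I])
  have "\<exists>M. \<forall>x\<in>\<Union>a\<in>S. (*) a ` T. p l x \<le> M" for l
    using prod[of l] submult[of l] by (auto intro: order_trans) (meson order_trans)
  then show "mbounded_in (ideal_bimodule p I) (\<Union>a\<in>S. lact (ideal_bimodule p I) a ` T)"
    using TI closed_ideal_simps[OF I]
    by (auto simp: mbounded_in_ideal_iff[OF I] seminorm_bounded_def ideal_bimodule_simps)
  have "\<exists>M. \<forall>x\<in>\<Union>a\<in>S. (\<lambda>x. x * a) ` T. p l x \<le> M" for l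
    using prod[of l] submult[of l] by (auto simp: mult.commute intro: order_trans) (metis order_trans mult.commute)
  then show "mbounded_in (ideal_bimodule p I) (\<Union>a\<in>S. (\<lambda>x. ract (ideal_bimodule p I) x a) ` T)"
    using TI closed_ideal_simps[OF I]
    by (auto simp: mbounded_in_ideal_iff[OF I] seminorm_bounded_def ideal_bimodule_simps)
qed (simp_all add: mcarrier_ideal ideal_bimodule_simps closed_ideal_simps[OF I] algebra_simps
    scaleC_scaleC scaleC_one mult_scaleC_left mult_scaleC_right)

end

section \<open>Ideals of the unitization\<close>

abbreviation embed :: "'a \<Rightarrow> 'a::complex_algebra unitization"
  where "embed a \<equiv> Unitization a 0"

abbreviation unit :: "'a::complex_algebra unitization"
  where "unit \<equiv> Unitization 0 1"

lemmas unitization_defs = zero_unitization_def plus_unitization_def minus_unitization_def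
  times_unitization_def scaleC_unitization_def

lemma unit_mult: "unit * z = z" "z * unit = z"
  by (simp_all add: times_unitization_def scaleC_one)

lemma unitization_decompose: "z = embed (algebra_part z) + scalar_part z *\<^sub>C unit"
  by (simp add: unitization_defs)

context seminormed_algebra
begin

abbreviation q :: "nat \<Rightarrow> 'a unitization \<Rightarrow> real" where "q \<equiv> unitization_seminorms p"

lemma seminormed_algebra_q: "seminormed_algebra q"
  using seminormed_algebra_unitization seminormed_algebra_axioms .

lemma continuous_embed: "continuous_map (seminorm_topology p) (seminorm_topology q) embed"
proof (rule continuous_map_linear[OF seminormed_algebra_q])
  show "\<exists>K l. \<forall>x. q m (embed x) \<le> K * p l x" for m
    by (intro exI[of _ 1] exI[of _ m]) (simp add: unitization_seminorms_def)
qed (simp add: unitization_defs)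

lemma continuous_scalar_part: "continuous_map (seminorm_topology q) euclidean scalar_part"
proof (rule seminormed_algebra.continuous_map_functional[OF seminormed_algebra_q])
  show "cmod (scalar_part z) \<le> 1 * q 0 z" for z :: "'a unitization"
    using nonneg by (simp add: unitization_seminorms_def)
qed (simp add: unitization_defs)

text \<open>The projection of the unitization onto the algebra along the line through
  \<open>Unitization u 1\<close>. With \<open>u\<close> the algebra part of a suitable
  \<open>j\<close>, it maps an ideal into its trace on the algebra.\<close>

lemma continuous_algebra_part_minus:
  "continuous_map (seminorm_topology q) (seminorm_topology p) (\<lambda>z. algebra_part z - scalar_part z *\<^sub>C u)"
proof (rule seminormed_algebra.continuous_map_linear[OF seminormed_algebra_q seminormed_algebra_axioms])
  have "p m (algebra_part z - scalar_part z *\<^sub>C u) \<le> (1 + p m u) * q m z" for m z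
  proof -
    have "p m (algebra_part z - scalar_part z *\<^sub>C u) \<le> p m (algebra_part z) + cmod (scalar_part z) * p m u"
      using triangle_diff[of m "algebra_part z" "scalar_part z *\<^sub>C u"] by (simp add: scale)
    also have "\<dots> \<le> (1 + p m u) * q m z"
      using nonneg[of m u] nonneg[of m "algebra_part z"]
      by (simp add: unitization_seminorms_def distrib_right distrib_left mult.commute)
    finally show ?thesis .
  qed
  then show "\<exists>K l. \<forall>z. p m (algebra_part z - scalar_part z *\<^sub>C u) \<le> K * q l z" for m by blast
qed (simp add: unitization_defs algebra_simps)

lemma continuous_algebra_part: "continuous_map (seminorm_topology q) (seminorm_topology p) algebra_part"
  using continuous_algebra_part_minus[of 0] by simp

lemma closed_ideal_embed_vimage:
  assumes "closed_ideal q J"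
  shows "closed_ideal p (embed -` J)"
  unfolding closed_ideal_def
proof (intro conjI)
  note J = closed_ideal_simps[OF assms]
  show "scaleC.subspace (embed -` J)"
    using J(1) J(2)[of "embed _" "embed _"] J(3)[of "embed _"]
    unfolding scaleC.subspace_def by (auto simp: unitization_defs)
  show "\<forall>a. \<forall>x\<in>embed -` J. a * x \<in> embed -` J \<and> x * a \<in> embed -` J"
    using J(5)[of "embed _" "embed _"] J(6)[of "embed _" "embed _"] by (auto simp: unitization_defs)
  show "closedin (seminorm_topology p) (embed -` J)"
    using closedin_continuous_map_preimage[OF continuous_embed, of J] assms
    by (simp add: closed_ideal_def vimage_def)
qed

text \<open>The adjoined scalars act by multiples, under which \<open>I\<close> is stable. For
  closedness the image is written as an intersection of preimages of closed sets under the two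
  continuous coordinates.\<close>

lemma closed_ideal_embed_image:
  assumes "closed_ideal p I"
  shows "closed_ideal q (embed ` I)"
  unfolding closed_ideal_def
proof (intro conjI)
  note I = closed_ideal_simps[OF assms]
  have eq: "embed ` I = {z. algebra_part z \<in> I} \<inter> {z. scalar_part z \<in> {0}}"
    by (auto intro!: image_eqI[of _ embed "algebra_part _"]) (metis unitization.collapse)
  show "scaleC.subspace (embed ` I)"
    using I unfolding eq scaleC.subspace_def by (simp add: unitization_defs)
  show "\<forall>a. \<forall>x\<in>embed ` I. a * x \<in> embed ` I \<and> x * a \<in> embed ` I"
    using I unfolding eq by (simp add: unitization_defs)
  have "closedin (seminorm_topology q) {z. algebra_part z \<in> I}"
    using closedin_continuous_map_preimage[OF continuous_algebra_part, of I] assms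
    by (simp add: closed_ideal_def seminormed_algebra.topspace[OF seminormed_algebra_q])
  moreover have "closedin (seminorm_topology q) {z. scalar_part z \<in> {0}}"
    using closedin_continuous_map_preimage[OF continuous_scalar_part, of "{0}"]
    by (simp add: seminormed_algebra.topspace[OF seminormed_algebra_q])
  ultimately show "closedin (seminorm_topology q) (embed ` I)"
    unfolding eq by (rule closedin_Int)
qed

text \<open>If \<open>J\<close> is not contained in \<open>A\<close>, it contains some \<open>j\<close> with scalar part 1, and \<open>a * j\<close> and \<open>j * a\<close> lie in
  the ideal \<open>J \<inter> A\<close> of codimension one.\<close>

lemma line_extension_ideal:
  assumes J: "closed_ideal q J"
  shows "line_extension True (\<forall>z\<in>J. scalar_part z = 0) embed (ideal_bimodule q J) (ideal_bimodule p (embed -` J))"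
proof -
  interpret Q: seminormed_algebra q by (rule seminormed_algebra_q)
  note ideal = closed_ideal_simps[OF J]
  \<comment> \<open>If \<open>J\<close> lies in the algebra, the choice \<open>j = 0\<close> makes
    the line trivial.\<close>
  define j where "j = (if \<forall>z\<in>J. scalar_part z = 0 then 0 else SOME j. j \<in> J \<and> scalar_part j = 1)"
  \<comment> \<open>One equation covers both cases: either \<open>scalar_part z\<close> is always 0,
    or \<open>scalar_part j = 1\<close>. It makes the scalar part of
    \<open>z - scalar_part z *\<^sub>C j\<close> vanish.\<close>
  have j: "j \<in> J \<and> (\<forall>z\<in>J. scalar_part z = scalar_part z * scalar_part j)"
  proof (cases "\<forall>z\<in>J. scalar_part z = 0")
    case False
    then obtain z where z: "z \<in> J" "scalar_part z \<noteq> 0" by blast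
    then have "(1 / scalar_part z) *\<^sub>C z \<in> J \<and> scalar_part ((1 / scalar_part z) *\<^sub>C z) = 1"
      using ideal(3)[OF z(1), of "1 / scalar_part z"] z(2) by (simp add: scaleC_unitization_def)
    then have "j \<in> J \<and> scalar_part j = 1" using False someI_ex[of "\<lambda>j. j \<in> J \<and> scalar_part j = 1"]
      unfolding j_def by auto
    then show ?thesis by simp
  qed (simp add: j_def ideal)
  define \<rho> where "\<rho> z = algebra_part z - scalar_part z *\<^sub>C algebra_part j" for z
  have dec: "embed (\<rho> z) = z - scalar_part z *\<^sub>C j" if "z \<in> J" for z
    using j that by (auto simp: \<rho>_def unitization_defs)
  then have \<rho>: "embed (\<rho> z) \<in> J" if "z \<in> J" for z
    using that j ideal by simp
  have ops: "mcarrier (ideal_bimodule q J) = J" "mcarrier (ideal_bimodule p (embed -` J)) = embed -` J"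
    by (simp_all only: Q.mcarrier_ideal mcarrier_ideal)
  show ?thesis
    unfolding line_extension_def ops
  proof (intro exI conjI impI ballI allI)
    show "continuous_linear (ideal_bimodule p (embed -` J)) (ideal_bimodule q J) embed"
      unfolding continuous_linear_def ops
      using continuous_embed
      by (auto simp: ideal_bimodule_simps continuous_map_in_subtopology unitization_defs
          intro: continuous_map_from_subtopology)
    have "continuous_map (seminorm_topology q) (seminorm_topology p) \<rho>"
      unfolding \<rho>_def by (rule continuous_algebra_part_minus)
    then show "continuous_linear (ideal_bimodule q J) (ideal_bimodule p (embed -` J)) \<rho>"
      unfolding continuous_linear_def ops using \<rho>
      by (auto simp: ideal_bimodule_simps continuous_map_in_subtopology intro: continuous_map_from_subtopology)
        (simp_all add: \<rho>_def unitization_defs algebra_simps scaleC_scaleC)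
    have "restrict scalar_part (mcarrier (ideal_bimodule q J)) \<in> continuous_functionals (ideal_bimodule q J)"
      using continuous_map_from_subtopology[OF continuous_scalar_part]
      by (intro topological_bimodule.functionalI[OF Q.topological_bimodule_ideal[OF J]])
        (auto simp: ideal_bimodule_simps unitization_defs)
    then show "restrict scalar_part J \<in> continuous_functionals (ideal_bimodule q J)"
      by (simp add: ops)
    show "j \<in> J" using j by blast
    show "equivariant id embed (ideal_bimodule p (embed -` J)) (ideal_bimodule q J) embed"
      unfolding equivariant_def by (simp add: ideal_bimodule_simps unitization_defs)
    show "madd (ideal_bimodule q J) (embed (\<rho> z)) (mscale (ideal_bimodule q J) (restrict scalar_part J z) j) = z"
      if "z \<in> J" for z
      using that by (simp add: ideal_bimodule_simps dec)
    show "\<rho> (embed a) = a" if "a \<in> embed -` J" for a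
      by (simp add: \<rho>_def)
    show "restrict scalar_part J (lact (ideal_bimodule q J) (embed a) z) = 0"
      "restrict scalar_part J (ract (ideal_bimodule q J) z (embed a)) = 0" if "z \<in> J" for a z
      using that ideal by (simp_all add: ideal_bimodule_simps) (simp_all add: unitization_defs)
    \<comment> \<open>In this case \<open>j = 0\<close>, and \<open>\<rho>\<close> is the algebra
      part, which is multiplicative on elements with scalar part 0.\<close>
    assume *: "\<forall>z\<in>J. scalar_part z = 0"
    then show "equivariant embed id (ideal_bimodule q J) (ideal_bimodule p (embed -` J)) \<rho>"
      unfolding equivariant_def ops by (simp add: ideal_bimodule_simps \<rho>_def unitization_defs)
    show "lact (ideal_bimodule q J) (embed a) j = mzero (ideal_bimodule q J)"
      "ract (ideal_bimodule q J) j (embed a) = mzero (ideal_bimodule q J)" for a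
      using * by (simp_all add: j_def ideal_bimodule_simps)
  qed
qed

end

section \<open>Iterated duals\<close>

text \<open>The type \<open>'c\<close> only bounds the size and need not be the acting algebra.
  Modules over the algebra and over its unitization thus share one assumption on room, with
  \<open>'c\<close> the unitization.\<close>

lemma copied_bimodule_lepoll:
  fixes X :: "('b::complex_algebra, 'x) bimodule"
  assumes "topological_bimodule p X" and "room_for_duals TYPE('c) TYPE('u) n" and "mcarrier X \<lesssim> (UNIV :: 'c set)"
  shows "copied_bimodule p X (copy_map X :: 'x \<Rightarrow> 'u)"
  using assms room_for_duals_inj_on_copy_map(1)
  by (auto intro!: copied_bimodule.intro copied_bimodule_axioms.intro)

lemma topological_bimodule_iterated_dual:
  fixes X :: "('b::complex_algebra, 'x) bimodule"
  assumes X: "topological_bimodule p X"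
    and room: "room_for_duals TYPE('c) TYPE('u) n" "mcarrier X \<lesssim> (UNIV :: 'c set)"
  shows "k \<le> n \<Longrightarrow> topological_bimodule p (iterated_dual k X :: ('b, 'u) bimodule)"
proof (induction k)
  case 0
  then show ?case
    using copied_bimodule.topological_bimodule_copy[OF copied_bimodule_lepoll[OF X room]] by simp
next
  case (Suc k)
  then have "topological_bimodule p (strong_dual (iterated_dual k X :: ('b, 'u) bimodule))"
    by (intro topological_bimodule.topological_bimodule_strong_dual) simp
  then have "copied_bimodule p (strong_dual (iterated_dual k X :: ('b, 'u) bimodule))
      (copy_map (strong_dual (iterated_dual k X)) :: _ \<Rightarrow> 'u)"
    using room_for_duals_inj_on_copy_map(2)[OF room] Suc.prems
    by (auto intro!: copied_bimodule.intro copied_bimodule_axioms.intro)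
  then show ?case
    using copied_bimodule.topological_bimodule_copy by simp
qed

lemma copied_bimodule_dual_iterated_dual:
  fixes X :: "('b::complex_algebra, 'x) bimodule"
  assumes X: "topological_bimodule p X"
    and room: "room_for_duals TYPE('c) TYPE('u) n" "mcarrier X \<lesssim> (UNIV :: 'c set)" and k: "k < n"
  shows "copied_bimodule p (strong_dual (iterated_dual k X :: ('b, 'u) bimodule))
    (copy_map (strong_dual (iterated_dual k X)) :: _ \<Rightarrow> 'u)"
  using room_for_duals_inj_on_copy_map(2)[OF room k] k
    topological_bimodule.topological_bimodule_strong_dual[OF topological_bimodule_iterated_dual[OF X room, of k]]
  by (auto intro!: copied_bimodule.intro copied_bimodule_axioms.intro)

text \<open>Each dualisation exchanges the two flags, so their original order is back at every even
  stage.\<close>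

lemma line_extension_iterated_dual:
  fixes X :: "('b::complex_algebra, 'x) bimodule" and Y :: "('a::complex_algebra, 'y) bimodule"
  assumes X: "topological_bimodule q X" and Y: "topological_bimodule p Y"
    and room: "room_for_duals TYPE('c) TYPE('u) n"
    and lepoll: "mcarrier X \<lesssim> (UNIV :: 'c set)" "mcarrier Y \<lesssim> (UNIV :: 'c set)"
    and ext: "line_extension sub quot \<theta> X Y"
  shows "k \<le> n \<Longrightarrow> line_extension (if even k then sub else quot) (if even k then quot else sub) \<theta>
    (iterated_dual k X :: ('b, 'u) bimodule) (iterated_dual k Y :: ('a, 'u) bimodule)"
proof (induction k)
  case 0
  then show ?case
    using line_extension_copy[OF copied_bimodule_lepoll[OF X room lepoll(1)] copied_bimodule_lepoll[OF Y room lepoll(2)] ext]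
    by simp
next
  case (Suc k)
  then have k: "k \<le> n" "k < n" by simp_all
  note tops = topological_bimodule_iterated_dual[OF X room lepoll(1) k(1)]
    topological_bimodule_iterated_dual[OF Y room lepoll(2) k(1)]
  show ?case
    using line_extension_copy[OF copied_bimodule_dual_iterated_dual[OF X room lepoll(1) k(2)]
        copied_bimodule_dual_iterated_dual[OF Y room lepoll(2) k(2)]
        line_extension_strong_dual[OF tops Suc.IH[OF k(1)]]]
    by (cases "even k") simp_all
qed

text \<open>Dualising turns each of the two properties into the other, starting from the functional
  version at stage 0.\<close>

lemma extends_iterated_dual:
  fixes X :: "('b::complex_algebra, 'x) bimodule"
  assumes X: "topological_bimodule p X"
    and room: "room_for_duals TYPE('c) TYPE('u) n" "mcarrier X \<lesssim> (UNIV :: 'c set)"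
    and ext: "extends_to_functional \<phi> X"
  shows "k \<le> n \<Longrightarrow> (even k \<longrightarrow> extends_to_functional \<phi> (iterated_dual k X :: ('b, 'u) bimodule)) \<and>
    (odd k \<longrightarrow> extends_to_vector \<phi> (iterated_dual k X :: ('b, 'u) bimodule))"
proof (induction k)
  case 0
  then show ?case
    using copied_bimodule.extends_to_functional_copy[OF copied_bimodule_lepoll[OF X room] ext] by simp
next
  case (Suc k)
  then have k: "k \<le> n" "k < n" by simp_all
  note top = topological_bimodule_iterated_dual[OF X room k(1)]
    and cop = copied_bimodule_dual_iterated_dual[OF X room k(2)]
  show ?case
    using Suc.IH[OF k(1)] copied_bimodule.extends_to_functional_copy[OF cop] copied_bimodule.extends_to_vector_copy[OF cop]
      topological_bimodule.extends_to_functional_strong_dual[OF top]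
      topological_bimodule.extends_to_vector_strong_dual[OF top]
    by simp
qed

definition unital_bimodule :: "'b \<Rightarrow> ('b, 'x) bimodule \<Rightarrow> bool"
  where "unital_bimodule e X \<longleftrightarrow> (\<forall>x\<in>mcarrier X. lact X e x = x \<and> ract X x e = x)"

lemma unital_bimodule_strong_dual: "unital_bimodule e X \<Longrightarrow> unital_bimodule e (strong_dual X)"
  unfolding unital_bimodule_def
  by (auto simp: mcarrier_strong_dual strong_dual_simps fun_eq_iff functional_undefined)

lemma (in copied_bimodule) unital_bimodule_copy: "unital_bimodule e X \<Longrightarrow> unital_bimodule e X'"
  unfolding unital_bimodule_def by (simp add: copy_simps from_copy_closed to_from_copy)

lemma unital_bimodule_iterated_dual:
  fixes X :: "('b::complex_algebra, 'x) bimodule"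
  assumes X: "topological_bimodule p X"
    and room: "room_for_duals TYPE('c) TYPE('u) n" "mcarrier X \<lesssim> (UNIV :: 'c set)"
    and unital: "unital_bimodule e X"
  shows "k \<le> n \<Longrightarrow> unital_bimodule e (iterated_dual k X :: ('b, 'u) bimodule)"
proof (induction k)
  case 0
  then show ?case
    using copied_bimodule.unital_bimodule_copy[OF copied_bimodule_lepoll[OF X room] unital] by simp
next
  case (Suc k)
  then have k: "k \<le> n" "k < n" by simp_all
  show ?case
    using copied_bimodule.unital_bimodule_copy[OF copied_bimodule_dual_iterated_dual[OF X room k(2)]
        unital_bimodule_strong_dual[OF Suc.IH[OF k(1)]]]
    by simp
qed

section \<open>Derivations\<close>

text \<open>A derivation is pulled back along an algebra homomorphism \<open>\<theta>\<close> and
  pushed forward along a map \<open>T\<close> that intertwines the actions over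
  \<open>\<theta>\<close>. It is used with the identity to change copies, and with
  \<open>embed\<close> to restrict from the unitization to the algebra.\<close>

lemma continuous_derivation_map:
  assumes D: "continuous_derivation q X D" and q: "seminormed_algebra q"
    and X: "topological_bimodule q X" and T: "continuous_linear X Y T" "equivariant \<theta> id X Y T"
    and \<theta>: "continuous_map (seminorm_topology p) (seminorm_topology q) \<theta>"
      "\<And>a b. \<theta> (a + b) = \<theta> a + \<theta> b" "\<And>c a. \<theta> (c *\<^sub>C a) = c *\<^sub>C \<theta> a" "\<And>a b. \<theta> (a * b) = \<theta> a * \<theta> b"
  shows "continuous_derivation p Y (\<lambda>a. T (D (\<theta> a)))"
proof -
  interpret X: topological_bimodule q X by fact
  have cont: "continuous_map (seminorm_topology q) (mtop X) D"
    using D unfolding continuous_derivation_def by blast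
  have closed: "D b \<in> mcarrier X" for b
    using cont seminormed_algebra.topspace[OF q] unfolding continuous_map_def by fastforce
  have "continuous_map (seminorm_topology p) (mtop Y) (T \<circ> (D \<circ> \<theta>))"
    using T(1) \<theta>(1) cont unfolding continuous_linear_def by (blast intro: continuous_map_compose)
  moreover have "T (D (\<theta> (a + b))) = madd Y (T (D (\<theta> a))) (T (D (\<theta> b)))" for a b
    using D closed by (simp add: continuous_derivation_def \<theta>(2) continuous_linear_add[OF T(1)])
  moreover have "T (D (\<theta> (c *\<^sub>C a))) = mscale Y c (T (D (\<theta> a)))" for c a
    using D closed by (simp add: continuous_derivation_def \<theta>(3) continuous_linear_scale[OF T(1)])
  moreover have "T (D (\<theta> (a * b))) = madd Y (lact Y a (T (D (\<theta> b)))) (ract Y (T (D (\<theta> a))) b)" for a b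
    using D closed equivariant_lact[OF T(2) closed] equivariant_ract[OF T(2) closed]
    by (simp add: continuous_derivation_def \<theta>(4) continuous_linear_add[OF T(1)] X.lact_closed X.ract_closed)
  ultimately show ?thesis unfolding continuous_derivation_def by (simp add: o_def)
qed

lemma inner_derivation_map:
  assumes "inner_derivation X D" and X: "topological_bimodule q X"
    and T: "continuous_linear X Y T" "equivariant \<theta> id X Y T"
  shows "inner_derivation Y (\<lambda>a. T (D (\<theta> a)))"
proof -
  interpret X: topological_bimodule q X by fact
  obtain x where x: "x \<in> mcarrier X" "\<And>b. D b = madd X (lact X b x) (mscale X (-1) (ract X x b))"
    using assms(1) unfolding inner_derivation_def by blast
  have "T (D (\<theta> a)) = madd Y (lact Y a (T x)) (mscale Y (-1) (ract Y (T x) a))" for a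
    using x(1) equivariant_lact[OF T(2) x(1)] equivariant_ract[OF T(2) x(1)]
    by (simp add: x(2) continuous_linear_add[OF T(1)] continuous_linear_scale[OF T(1)]
        X.lact_closed X.ract_closed X.scale_closed)
  then show ?thesis
    using continuous_linear_closed[OF T(1) x(1)] unfolding inner_derivation_def by blast
qed

section \<open>Passing between the algebra and its unitization\<close>

context seminormed_algebra
begin

lemma derivation_closed:
  assumes "continuous_derivation p X D"
  shows "D a \<in> mcarrier X"
  using assms topspace unfolding continuous_derivation_def continuous_map_def by fastforce

lemma derivations_copy_inner_iff:
  fixes c :: "'x \<Rightarrow> 'u"
  assumes "copied_bimodule p X c"
  shows "(\<forall>D. continuous_derivation p (copy X :: ('a, 'u) bimodule) D \<longrightarrow> inner_derivation (copy X :: ('a, 'u) bimodule) D)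
    \<longleftrightarrow> (\<forall>D. continuous_derivation p X D \<longrightarrow> inner_derivation X D)" (is "?copy \<longleftrightarrow> ?orig")
proof -
  interpret X: copied_bimodule p X c by fact
  note id = continuous_map_id[of "seminorm_topology p", unfolded id_def]
  note to_props = X.topological_bimodule_axioms X.continuous_linear_to_copy X.equivariant_to_copy[of "\<lambda>x. x", folded id_def]
  note from_props = X.topological_bimodule_copy X.continuous_linear_from_copy X.equivariant_from_copy[of "\<lambda>x. x", folded id_def]
  show ?thesis
  proof (intro iffI allI impI)
    fix D assume copy: ?copy and D: "continuous_derivation p X D"
    have "continuous_derivation p X.X' (\<lambda>a. c (D (id a)))"
      using D seminormed_algebra_axioms to_props by (rule continuous_derivation_map) (simp_all add: continuous_map_id)
    then have "inner_derivation X.X' (\<lambda>a. c (D a))" using copy by simp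
    from inner_derivation_map[OF this from_props] show "inner_derivation X D"
      by (simp add: X.from_to_copy derivation_closed[OF D])
  next
    fix D assume orig: ?orig and D: "continuous_derivation p X.X' D"
    have "continuous_derivation p X (\<lambda>a. X.from_copy (D (id a)))"
      using D seminormed_algebra_axioms from_props by (rule continuous_derivation_map) (simp_all add: continuous_map_id)
    then have "inner_derivation X (\<lambda>a. X.from_copy (D a))" using orig by simp
    from inner_derivation_map[OF this to_props] show "inner_derivation X.X' D"
      by (simp add: X.to_from_copy derivation_closed[OF D])
  qed
qed

text \<open>Only the outermost copy is removed: derivations into \<open>strong_dual\<close> have
  functionals as values, which can be evaluated at points, unlike their copies in
  \<open>'u\<close>.\<close>

lemma ideally_amenable_Suc_iff:
  assumes room: "room_for_duals TYPE('c) TYPE('u) (Suc k)" and lepoll: "(UNIV :: 'a set) \<lesssim> (UNIV :: 'c set)"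
  shows "ideally_amenable TYPE('u) (Suc k) p \<longleftrightarrow>
    (\<forall>I. closed_ideal p I \<longrightarrow> (\<forall>D.
       continuous_derivation p (strong_dual (iterated_dual k (ideal_bimodule p I) :: ('a, 'u) bimodule)) D \<longrightarrow>
       inner_derivation (strong_dual (iterated_dual k (ideal_bimodule p I) :: ('a, 'u) bimodule)) D))"
proof -
  have "copied_bimodule p (strong_dual (iterated_dual k (ideal_bimodule p I) :: ('a, 'u) bimodule))
      (copy_map (strong_dual (iterated_dual k (ideal_bimodule p I))) :: _ \<Rightarrow> 'u)" if "closed_ideal p I" for I
    using topological_bimodule_ideal[OF that] room
  proof (rule copied_bimodule_dual_iterated_dual)
    show "mcarrier (ideal_bimodule p I) \<lesssim> (UNIV :: 'c set)"
      using subset_imp_lepoll lepoll by (rule lepoll_trans) simp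
  qed simp
  from derivations_copy_inner_iff[OF this] show ?thesis
    unfolding ideally_amenable_def iterated_dual.simps by blast
qed

text \<open>Applied with \<open>Z\<close> the even iterated dual of the whole algebra;
  \<open>\<psi>\<close> is then the canonical image of \<open>\<phi>\<close>.\<close>

lemma functional_vanishing_on_products:
  assumes Z: "topological_bimodule p Z"
    and inner: "\<And>D. continuous_derivation p (strong_dual Z) D \<Longrightarrow> inner_derivation (strong_dual Z) D"
    and ext: "extends_to_functional \<phi> Z"
    and \<phi>: "continuous_map (seminorm_topology p) euclidean \<phi>"
      "\<And>a b. \<phi> (a + b) = \<phi> a + \<phi> b" "\<And>c a. \<phi> (c *\<^sub>C a) = c * \<phi> a" "\<And>a b. \<phi> (a * b) = 0"
  shows "\<phi> a = 0"
proof -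
  interpret Z: topological_bimodule p Z by fact
  interpret dual: topological_bimodule p "strong_dual Z" by (rule Z.topological_bimodule_strong_dual)
  obtain \<psi> where \<psi>: "\<psi> \<in> continuous_functionals Z"
    "\<And>b x. x \<in> mcarrier Z \<Longrightarrow> \<psi> (lact Z b x) = 0 \<and> \<psi> (ract Z x b) = 0"
    "\<And>a. \<exists>x\<in>mcarrier Z. lact Z a x = ract Z x a \<and> \<psi> x = \<phi> a"
    using ext unfolding extends_to_functional_def by blast
  \<comment> \<open>Both sides of the product rule are zero: \<open>\<phi>\<close> vanishes on
    products, and \<open>\<psi>\<close> is annihilated by both actions.\<close>
  let ?D = "\<lambda>a. mscale (strong_dual Z) (\<phi> a) \<psi>"
  have "continuous_map euclidean (mtop (strong_dual Z)) (\<lambda>c. mscale (strong_dual Z) c \<psi>)"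
    using \<psi>(1) by (intro dual.continuous_scale) (simp add: mcarrier_strong_dual)
  from continuous_map_compose[OF \<phi>(1) this]
  have "continuous_map (seminorm_topology p) (mtop (strong_dual Z)) ?D" by (simp add: o_def)
  then have "continuous_derivation p (strong_dual Z) ?D"
    unfolding continuous_derivation_def
    by (simp add: strong_dual_simps fun_eq_iff \<phi> \<psi>(2) Z.lact_closed Z.ract_closed algebra_simps)
  then obtain f where f: "f \<in> continuous_functionals Z"
    "\<And>b. ?D b = madd (strong_dual Z) (lact (strong_dual Z) b f) (mscale (strong_dual Z) (-1) (ract (strong_dual Z) f b))"
    using inner unfolding inner_derivation_def mcarrier_strong_dual by blast
  \<comment> \<open>As \<open>x\<close> commutes with \<open>a\<close>, the inner derivation at
    \<open>a\<close> is zero at \<open>x\<close>, while \<open>?D a\<close> has the value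
    \<open>\<phi> a * \<psi> x\<close> there.\<close>
  obtain x where x: "x \<in> mcarrier Z" "lact Z a x = ract Z x a" "\<psi> x = \<phi> a" using \<psi>(3) by blast
  have "\<phi> a * \<phi> a = 0"
    using fun_cong[OF f(2)[of a], of x] x by (simp add: strong_dual_simps)
  then show ?thesis by simp
qed

text \<open>The main step of (ii), for \<open>X\<close> and \<open>Y\<close> the even iterated duals
  of an ideal of the unitization and of its trace on the algebra. The functional that implements
  \<open>D\<close> on \<open>Y\<close> is extended to \<open>X\<close>, and \<open>vanish\<close>
  removes the remaining error.\<close>

lemma inner_derivation_extension:
  assumes X: "topological_bimodule q X" and Y: "topological_bimodule p Y"
    and ext: "line_extension True quot embed X Y" and unital: "unital_bimodule unit X"
    and inner: "\<And>E. continuous_derivation p (strong_dual Y) E \<Longrightarrow> inner_derivation (strong_dual Y) E"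
    and vanish: "\<And>\<phi> a. \<lbrakk>continuous_map (seminorm_topology p) euclidean \<phi>; \<And>a b. \<phi> (a + b) = \<phi> a + \<phi> b;
      \<And>c a. \<phi> (c *\<^sub>C a) = c * \<phi> a; \<And>a b. \<phi> (a * b) = 0\<rbrakk> \<Longrightarrow> \<phi> a = 0"
    and D: "continuous_derivation q (strong_dual X) D"
  shows "inner_derivation (strong_dual X) D"
proof -
  interpret X: topological_bimodule q X by fact
  interpret Y: topological_bimodule p Y by fact
  interpret Q: seminormed_algebra q by (rule seminormed_algebra_q)
  obtain \<iota> \<rho> \<psi> j where \<iota>: "continuous_linear Y X \<iota>" and \<rho>: "continuous_linear X Y \<rho>"
    and \<psi>: "\<psi> \<in> continuous_functionals X" and j: "j \<in> mcarrier X"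
    and inv: "\<And>y. y \<in> mcarrier Y \<Longrightarrow> \<rho> (\<iota> y) = y"
    and dec: "\<And>x. x \<in> mcarrier X \<Longrightarrow> madd X (\<iota> (\<rho> x)) (mscale X (\<psi> x) j) = x"
    and equi: "equivariant id embed Y X \<iota>"
    and kill: "\<And>a x. x \<in> mcarrier X \<Longrightarrow> \<psi> (lact X (embed a) x) = 0 \<and> \<psi> (ract X x (embed a)) = 0"
    using ext unfolding line_extension_def by metis
  note closed = continuous_linear_closed[OF \<iota>] continuous_linear_closed[OF \<rho>]
    X.lact_closed X.ract_closed X.scale_closed X.add_closed Y.lact_closed Y.ract_closed
  have DX: "D z \<in> continuous_functionals X" for z
    using Q.derivation_closed[OF D] by (simp add: mcarrier_strong_dual)
  have D_add: "D (z + w) x = D z x + D w x" and D_scale: "D (c *\<^sub>C z) x = c * D z x"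
    and D_mult: "D (z * w) x = D w (ract X x z) + D z (lact X w x)" if "x \<in> mcarrier X" for z w c x
    using D that unfolding continuous_derivation_def by (simp_all add: strong_dual_simps)
  have "continuous_derivation p (strong_dual Y) (\<lambda>a. dual_map Y \<iota> (D (embed a)))"
    using D Q.seminormed_algebra_axioms X.topological_bimodule_strong_dual
      continuous_linear_dual_map[OF Y X \<iota>] equivariant_dual_map[OF Y X \<iota> equi] continuous_embed
    by (rule continuous_derivation_map) (simp_all add: unitization_defs)
  from inner[OF this] obtain f where f: "f \<in> continuous_functionals Y"
    "\<And>a. dual_map Y \<iota> (D (embed a)) =
      madd (strong_dual Y) (lact (strong_dual Y) a f) (mscale (strong_dual Y) (-1) (ract (strong_dual Y) f a))"
    unfolding inner_derivation_def mcarrier_strong_dual by blast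
  \<comment> \<open>The extension of \<open>f\<close> to \<open>X\<close> through the projection; it
    agrees with \<open>f\<close> on the image of \<open>\<iota>\<close>.\<close>
  define g where "g = dual_map X \<rho> f"
  have g: "g \<in> continuous_functionals X" unfolding g_def using X \<rho> f(1) by (rule dual_map_closed)
  \<comment> \<open>The difference at \<open>embed a\<close> between \<open>D\<close> and the inner
    derivation given by \<open>g\<close>. It vanishes on \<open>Y\<close> by the choice of
    \<open>f\<close>, so it is determined by its value \<open>\<phi> a\<close> at
    \<open>j\<close>.\<close>
  define \<Delta> where "\<Delta> a x = D (embed a) x - g (ract X x (embed a)) + g (lact X (embed a) x)" for a x
  define \<phi> where "\<phi> a = \<Delta> a j" for a
  have \<Delta>\<iota>: "\<Delta> a (\<iota> y) = 0" if y: "y \<in> mcarrier Y" for a y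
  proof -
    have "D (embed a) (\<iota> y) = f (ract Y y a) - f (lact Y a y)"
      using fun_cong[OF f(2)[of a], of y] y by (simp add: dual_map_def strong_dual_simps)
    moreover have "g (ract X (\<iota> y) (embed a)) = f (ract Y y a)" "g (lact X (embed a) (\<iota> y)) = f (lact Y a y)"
      using equivariant_ract[OF equi y, of a] equivariant_lact[OF equi y, of a] y
      by (simp_all add: g_def dual_map_def closed inv flip: id_apply) (metis closed(3,4,7,8) inv id_apply)+
    ultimately show ?thesis by (simp add: \<Delta>_def)
  qed
  have \<Delta>: "\<Delta> a x = \<psi> x * \<phi> a" if x: "x \<in> mcarrier X" for a x
  proof -
    have "\<Delta> a x = \<Delta> a (madd X (\<iota> (\<rho> x)) (mscale X (\<psi> x) j))" using dec[OF x] by simp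
    also have "\<dots> = \<Delta> a (\<iota> (\<rho> x)) + \<psi> x * \<Delta> a j"
      using x j by (simp add: \<Delta>_def closed functional_add[OF DX] functional_scale[OF DX]
          functional_add[OF g] functional_scale[OF g] continuous_linear_add[OF X.linear_lact]
          continuous_linear_add[OF X.linear_ract] continuous_linear_scale[OF X.linear_lact]
          continuous_linear_scale[OF X.linear_ract] algebra_simps)
    finally show ?thesis using x by (simp add: \<Delta>\<iota> closed \<phi>_def)
  qed
  have embed: "embed (a + b) = embed a + embed b" "embed (c *\<^sub>C a) = c *\<^sub>C embed a"
    "embed (a * b) = embed a * embed b" for a b :: 'a and c
    by (simp_all add: unitization_defs)
  define \<beta> where "\<beta> a = g (lact X (embed a) j) - g (ract X j (embed a))" for a
  have \<beta>_add: "\<beta> (a + b) = \<beta> a + \<beta> b" and \<beta>_scale: "\<beta> (c *\<^sub>C a) = c * \<beta> a" for a b c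
    by (simp_all add: \<beta>_def embed j X.lact_plus X.ract_plus X.lact_scaleC X.ract_scaleC closed
        functional_add[OF g] functional_scale[OF g] algebra_simps)
  \<comment> \<open>For fixed \<open>j\<close> the module axioms do not state continuity of the
    actions in \<open>a\<close>, only that bounded sets of \<open>a\<close> give bounded sets of
    vectors. For a linear functional on a space with countably many increasing seminorms this
    suffices.\<close>
  have "continuous_map (seminorm_topology p) euclidean \<beta>"
  proof (rule continuous_map_functional_bounded)
    show "\<beta> (a - b) = \<beta> a - \<beta> b" for a b
      using \<beta>_add[of "a - b" b] by simp
    fix S assume S: "\<And>l. \<exists>M. \<forall>a\<in>S. p l a \<le> M"
    have "seminorm_bounded q (embed ` S)"
      using S unfolding seminorm_bounded_def by (simp add: unitization_seminorms_def)
    from X.functional_bounded[OF g X.bounded_lact[OF this X.mbounded_in_singleton[OF j]]]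
      X.functional_bounded[OF g X.bounded_ract[OF this X.mbounded_in_singleton[OF j]]]
    obtain M N where "\<forall>a\<in>S. cmod (g (lact X (embed a) j)) \<le> M" "\<forall>a\<in>S. cmod (g (ract X j (embed a))) \<le> N"
      by auto
    then have "\<forall>a\<in>S. cmod (\<beta> a) \<le> M + N"
      unfolding \<beta>_def by (simp add: add_mono norm_triangle_le_diff)
    then show "\<exists>M. \<forall>a\<in>S. cmod (\<beta> a) \<le> M" by blast
  qed (rule \<beta>_scale)
  moreover have "continuous_map (seminorm_topology p) euclidean (\<lambda>a. D (embed a) j)"
  proof -
    have "continuous_map (seminorm_topology q) (strong_topology X) D"
      using D unfolding continuous_derivation_def by (simp add: strong_dual_simps)
    from continuous_map_compose[OF continuous_map_compose[OF continuous_embed this] X.continuous_map_evaluation[OF j]]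
    show ?thesis by (simp add: o_def)
  qed
  ultimately have "continuous_map (seminorm_topology p) euclidean (\<lambda>a. D (embed a) j + \<beta> a)"
    by (intro continuous_map_add)
  moreover have \<phi>_eq: "\<phi> = (\<lambda>a. D (embed a) j + \<beta> a)"
    by (simp add: fun_eq_iff \<phi>_def \<Delta>_def \<beta>_def)
  ultimately have "continuous_map (seminorm_topology p) euclidean \<phi>" by simp
  moreover have "\<phi> (a + b) = \<phi> a + \<phi> b" "\<phi> (c *\<^sub>C a) = c * \<phi> a" for a b c
    using D_add[OF j] D_scale[OF j] by (simp_all add: \<phi>_eq \<beta>_add \<beta>_scale embed algebra_simps)
  moreover have "\<phi> (a * b) = 0" for a b
  proof -
    \<comment> \<open>\<open>\<psi>\<close> kills both vectors, so at them \<open>D\<close> agrees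
      with the inner derivation of \<open>g\<close>. In the product rule for \<open>D\<close> at
      \<open>a * b\<close>, evaluated at \<open>j\<close>, the mixed terms
      \<open>g (b \<cdot> j \<cdot> a)\<close> cancel and exactly \<open>- \<beta> (a * b)\<close>
      remains.\<close>
    have "\<Delta> b (ract X j (embed a)) = 0" "\<Delta> a (lact X (embed b) j) = 0"
      using kill[OF j] j by (simp_all add: \<Delta> closed)
    then have "D (embed b) (ract X j (embed a)) + D (embed a) (lact X (embed b) j) =
        g (ract X j (embed a * embed b)) - g (lact X (embed a * embed b) j)"
      using j by (simp add: \<Delta>_def X.ract_times X.lact_times X.lact_ract) algebra
    then show ?thesis
      using j by (simp add: \<phi>_eq \<beta>_def embed D_mult)
  qed
  ultimately have "\<phi> a = 0" for a by (rule vanish)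
  then have D_embed: "D (embed a) x = g (ract X x (embed a)) - g (lact X (embed a) x)" if "x \<in> mcarrier X" for a x
    using \<Delta>[OF that, of a] by (simp add: \<Delta>_def algebra_simps)
  have act_unit: "lact X unit x = x" "ract X x unit = x" if "x \<in> mcarrier X" for x
    using unital that unfolding unital_bimodule_def by auto
  \<comment> \<open>The product rule for \<open>unit * unit\<close> reads
    \<open>D unit = D unit + D unit\<close>.\<close>
  have D_unit: "D unit x = 0" if "x \<in> mcarrier X" for x
    using D_mult[OF that, of unit unit] that by (simp add: unit_mult act_unit)
  have "D z = madd (strong_dual X) (lact (strong_dual X) z g) (mscale (strong_dual X) (-1) (ract (strong_dual X) g z))" for z
  proof
    fix x
    show "D z x = madd (strong_dual X) (lact (strong_dual X) z g) (mscale (strong_dual X) (-1) (ract (strong_dual X) g z)) x"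
    proof (cases "x \<in> mcarrier X")
      case True
      let ?a = "embed (algebra_part z)" and ?s = "scalar_part z"
      have "D z x = g (ract X x ?a) - g (lact X ?a x)"
        using True by (subst unitization_decompose[of z]) (simp add: D_add D_scale D_unit D_embed)
      \<comment> \<open>The identity acts equally on both sides, so the added scalar terms
        cancel.\<close>
      also have "\<dots> = g (ract X x (?a + ?s *\<^sub>C unit)) - g (lact X (?a + ?s *\<^sub>C unit) x)"
        using True by (simp add: X.lact_plus X.ract_plus X.lact_scaleC X.ract_scaleC act_unit closed
            functional_add[OF g] functional_scale[OF g])
      finally show ?thesis
        using True by (simp add: strong_dual_simps unitization_decompose[symmetric])
    qed (simp add: strong_dual_simps functional_undefined[OF DX])
  qed
  then show ?thesis
    unfolding inner_derivation_def mcarrier_strong_dual using g by blast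
qed

text \<open>The main step of (i). \<open>Y\<close> is an equivariant retract of \<open>X\<close>:
  the derivation is extended to the unitization with values in \<open>X\<close> through
  \<open>\<iota>\<close>, and the element implementing it there is mapped back by
  \<open>\<rho>\<close>.\<close>

lemma inner_derivation_retract:
  assumes X: "topological_bimodule q X" and Y: "topological_bimodule p Y"
    and ext: "line_extension True True embed X Y" and unital: "unital_bimodule unit X"
    and inner: "\<And>E. continuous_derivation q X E \<Longrightarrow> inner_derivation X E"
    and D: "continuous_derivation p Y D"
  shows "inner_derivation Y D"
proof -
  interpret X: topological_bimodule q X by fact
  interpret Y: topological_bimodule p Y by fact
  obtain \<iota> \<rho> where \<iota>: "continuous_linear Y X \<iota>" "equivariant id embed Y X \<iota>"
    and \<rho>: "continuous_linear X Y \<rho>" "equivariant embed id X Y \<rho>"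
    and inv: "\<And>y. y \<in> mcarrier Y \<Longrightarrow> \<rho> (\<iota> y) = y"
    using ext unfolding line_extension_def by metis
  have DY: "D a \<in> mcarrier Y" for a using derivation_closed[OF D] .
  have \<iota>X: "\<iota> (D a) \<in> mcarrier X" for a using continuous_linear_closed[OF \<iota>(1) DY] .
  note closed = DY \<iota>X X.lact_closed X.ract_closed X.scale_closed X.add_closed
    Y.lact_closed Y.ract_closed Y.scale_closed Y.add_closed
  have act_unit: "lact X unit x = x" "ract X x unit = x" if "x \<in> mcarrier X" for x
    using unital that unfolding unital_bimodule_def by auto
  have act: "lact X z x = madd X (lact X (embed (algebra_part z)) x) (mscale X (scalar_part z) x)"
    "ract X x z = madd X (ract X x (embed (algebra_part z))) (mscale X (scalar_part z) x)"
    if "x \<in> mcarrier X" for x z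
    using that X.lact_plus[OF that, of "embed (algebra_part z)" "scalar_part z *\<^sub>C unit"]
      X.ract_plus[OF that, of "embed (algebra_part z)" "scalar_part z *\<^sub>C unit"]
    by (simp_all add: X.lact_scaleC X.ract_scaleC act_unit unitization_decompose[symmetric])
  have D_eqs: "D (a + b) = madd Y (D a) (D b)" "D (c *\<^sub>C a) = mscale Y c (D a)"
    "D (a * b) = madd Y (lact Y a (D b)) (ract Y (D a) b)" for a b c
    using D unfolding continuous_derivation_def by blast+
  have \<iota>_act: "\<iota> (lact Y a (D b)) = lact X (embed a) (\<iota> (D b))" "\<iota> (ract Y (D a) b) = ract X (\<iota> (D a)) (embed b)" for a b
    using equivariant_lact[OF \<iota>(2) DY] equivariant_ract[OF \<iota>(2) DY] by simp_all
  \<comment> \<open>Forgetting the scalar part extends \<open>D\<close> by 0 on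
    \<open>unit\<close>.\<close>
  let ?E = "\<lambda>z. \<iota> (D (algebra_part z))"
  have "continuous_map (seminorm_topology q) (mtop X) (\<iota> \<circ> (D \<circ> algebra_part))"
    using \<iota>(1) D continuous_algebra_part unfolding continuous_linear_def continuous_derivation_def
    by (blast intro: continuous_map_compose)
  moreover have "?E (z + w) = madd X (?E z) (?E w)" "?E (c *\<^sub>C z) = mscale X c (?E z)" for z w c
    by (simp_all add: unitization_defs D_eqs continuous_linear_add[OF \<iota>(1)] continuous_linear_scale[OF \<iota>(1)] closed)
  moreover have "?E (z * w) = madd X (lact X z (?E w)) (ract X (?E z) w)" for z w
  proof -
    let ?P = "lact X (embed (algebra_part z)) (?E w)" and ?Q = "ract X (?E z) (embed (algebra_part w))"
    let ?U = "mscale X (scalar_part w) (?E z)" and ?V = "mscale X (scalar_part z) (?E w)"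
    have "?E (z * w) = madd X (madd X (madd X ?P ?Q) ?U) ?V"
      by (simp add: unitization_defs D_eqs continuous_linear_add[OF \<iota>(1)] continuous_linear_scale[OF \<iota>(1)]
          closed \<iota>_act)
    also have "\<dots> = madd X ?P (madd X (madd X ?Q ?U) ?V)"
      by (simp add: X.add_assoc closed)
    \<comment> \<open>The summands are regrouped so that each scalar multiple joins the action it
      belongs to: \<open>?V\<close> the left action of \<open>z\<close>, \<open>?U\<close> the right
      action of \<open>w\<close>.\<close>
    also have "madd X (madd X ?Q ?U) ?V = madd X ?V (madd X ?Q ?U)"
      by (simp add: X.add_commute closed)
    also have "madd X ?P \<dots> = madd X (madd X ?P ?V) (madd X ?Q ?U)"
      by (simp add: X.add_assoc closed)
    finally show ?thesis by (simp add: act(1)[of _ z] act(2)[of _ w] closed)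
  qed
  ultimately have "continuous_derivation q X ?E"
    unfolding continuous_derivation_def by (simp add: o_def)
  \<comment> \<open>Restricted along \<open>embed\<close> and followed by \<open>\<rho>\<close>, the
    extension \<open>?E\<close> is \<open>D\<close> again.\<close>
  from inner_derivation_map[OF inner[OF this] X \<rho>] show ?thesis
    by (simp add: inv DY)
qed

end

lemma lepoll_unitization: "(UNIV :: 'a set) \<lesssim> (UNIV :: 'a::complex_algebra unitization set)"
  unfolding lepoll_def by (intro exI[of _ embed]) (auto simp: inj_def)

theorem proposition3p8:
  fixes p :: "nat \<Rightarrow> 'a::complex_algebra \<Rightarrow> real" and n :: nat
  assumes "frechet_algebra p"
    and "\<not> unital_algebra TYPE('a)"
    and "1 \<le> n"
    and "room_for_duals TYPE('a unitization) TYPE('u) (2 * n - 1)"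
  shows "(ideally_amenable TYPE('u) n (unitization_seminorms p) \<longrightarrow>
            ideally_amenable TYPE('u) n p) \<and>
         (ideally_amenable TYPE('u) (2 * n - 1) p \<longrightarrow>
            ideally_amenable TYPE('u) (2 * n - 1) (unitization_seminorms p))"
proof -
  interpret seminormed_algebra p
    by unfold_locales (use assms(1) in \<open>simp_all add: frechet_algebra_def\<close>)
  interpret Q: seminormed_algebra q by (rule seminormed_algebra_q)
  note room = assms(4)
  have lepoll: "mcarrier (ideal_bimodule p I) \<lesssim> (UNIV :: 'a unitization set)" for I
    using lepoll_trans[OF subset_imp_lepoll lepoll_unitization] by blast
  have lepoll': "mcarrier (ideal_bimodule q J) \<lesssim> (UNIV :: 'a unitization set)" for J
    by (simp add: subset_imp_lepoll)
  have unital: "unital_bimodule unit (ideal_bimodule q J)" for J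
    by (simp add: unital_bimodule_def ideal_bimodule_simps unit_mult)
  show ?thesis
  proof (intro conjI impI)
    assume amenable: "ideally_amenable TYPE('u) n q"
    \<comment> \<open>The room for \<open>2 * n - 1\<close> duals also serves for the
      \<open>n\<close> duals in (i).\<close>
    have n: "n \<le> 2 * n - 1" using assms(3) by simp
    show "ideally_amenable TYPE('u) n p"
      unfolding ideally_amenable_def
    proof (intro allI impI, elim conjE)
      fix I D assume I: "closed_ideal p I"
        and D: "continuous_derivation p (iterated_dual n (ideal_bimodule p I) :: ('a, 'u) bimodule) D"
      have J: "closed_ideal q (embed ` I)" using I by (rule closed_ideal_embed_image)
      have "embed -` embed ` I = I" by (auto simp: inj_def)
      \<comment> \<open>The image of \<open>I\<close> has scalar parts 0, so both flags are
        \<open>True\<close> and the parity of \<open>n\<close> makes no difference.\<close>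
      then have "line_extension True True embed (ideal_bimodule q (embed ` I)) (ideal_bimodule p I)"
        using line_extension_ideal[OF J] by simp
      from line_extension_iterated_dual[OF Q.topological_bimodule_ideal[OF J] topological_bimodule_ideal[OF I]
          room lepoll' lepoll this n]
      have "line_extension True True embed (iterated_dual n (ideal_bimodule q (embed ` I)) :: ('a unitization, 'u) bimodule)
          (iterated_dual n (ideal_bimodule p I) :: ('a, 'u) bimodule)" by simp
      then show "inner_derivation (iterated_dual n (ideal_bimodule p I) :: ('a, 'u) bimodule) D"
      proof (rule inner_derivation_retract[rotated 2])
        show "inner_derivation (iterated_dual n (ideal_bimodule q (embed ` I)) :: ('a unitization, 'u) bimodule) E"
          if "continuous_derivation q (iterated_dual n (ideal_bimodule q (embed ` I)) :: ('a unitization, 'u) bimodule) E" for E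
          using amenable J that unfolding ideally_amenable_def by blast
      qed (use D in \<open>simp_all add: topological_bimodule_iterated_dual[OF Q.topological_bimodule_ideal[OF J] room lepoll' n]
          topological_bimodule_iterated_dual[OF topological_bimodule_ideal[OF I] room lepoll n]
          unital_bimodule_iterated_dual[OF Q.topological_bimodule_ideal[OF J] room lepoll' unital n]\<close>)
    qed
  next
    assume amenable: "ideally_amenable TYPE('u) (2 * n - 1) p"
    \<comment> \<open>The outermost dual is split off, leaving an even number of duals below it;
      \<open>1 \<le> n\<close> keeps the subtraction exact.\<close>
    define k where "k = 2 * n - 2"
    have k: "2 * n - 1 = Suc k" "even k" "k \<le> 2 * n - 1" using assms(3) by (auto simp: k_def)
    note inner = amenable[unfolded k(1) ideally_amenable_Suc_iff[OF room[unfolded k(1)] lepoll_unitization], rule_format]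
    \<comment> \<open>To exclude nonzero functionals vanishing on products, amenability is applied
      to the whole algebra as an ideal of itself.\<close>
    have UNIV: "closed_ideal p UNIV"
      unfolding closed_ideal_def using closedin_topspace[of "seminorm_topology p"] by simp
    have vanish: "\<phi> a = 0"
      if \<phi>: "continuous_map (seminorm_topology p) euclidean \<phi>" "\<And>a b. \<phi> (a + b) = \<phi> a + \<phi> b"
        "\<And>c a. \<phi> (c *\<^sub>C a) = c * \<phi> a" "\<And>a b. \<phi> (a * b) = 0" for \<phi> a
    proof -
      have "restrict \<phi> (mcarrier (ideal_bimodule p UNIV)) \<in> continuous_functionals (ideal_bimodule p UNIV)"
        using \<phi> by (intro topological_bimodule.functionalI[OF topological_bimodule_ideal[OF UNIV]])
          (simp_all add: ideal_bimodule_simps)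
      then have "\<phi> \<in> continuous_functionals (ideal_bimodule p UNIV)"
        by (simp add: mcarrier_ideal restrict_UNIV)
      \<comment> \<open>At stage 0 the element assigned to \<open>a\<close> is \<open>a\<close>
        itself.\<close>
      then have "extends_to_functional \<phi> (ideal_bimodule p UNIV)"
        unfolding extends_to_functional_def mcarrier_ideal using \<phi>(4)
        by (intro bexI[of _ \<phi>]) (auto simp: ideal_bimodule_simps)
      from extends_iterated_dual[OF topological_bimodule_ideal[OF UNIV] room lepoll this k(3)] k(2)
      have "extends_to_functional \<phi> (iterated_dual k (ideal_bimodule p UNIV) :: ('a, 'u) bimodule)" by blast
      from functional_vanishing_on_products[OF topological_bimodule_iterated_dual[OF topological_bimodule_ideal[OF UNIV]
            room lepoll k(3)] inner[OF UNIV] this \<phi>]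
      show ?thesis .
    qed
    show "ideally_amenable TYPE('u) (2 * n - 1) q"
      unfolding k(1) Q.ideally_amenable_Suc_iff[OF room[unfolded k(1)] lepoll_refl]
    proof (intro allI impI)
      fix J D assume J: "closed_ideal q J"
        and D: "continuous_derivation q (strong_dual (iterated_dual k (ideal_bimodule q J) :: ('a unitization, 'u) bimodule)) D"
      have I: "closed_ideal p (embed -` J)" using J by (rule closed_ideal_embed_vimage)
      note X = topological_bimodule_iterated_dual[OF Q.topological_bimodule_ideal[OF J] room lepoll' k(3)]
        and Y = topological_bimodule_iterated_dual[OF topological_bimodule_ideal[OF I] room lepoll k(3)]
      \<comment> \<open>Since \<open>k\<close> is even, the flags keep their order: the dual of the
        trace ideal is again a submodule with trivial quotient.\<close>
      from line_extension_iterated_dual[OF Q.topological_bimodule_ideal[OF J] topological_bimodule_ideal[OF I]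
          room lepoll' lepoll line_extension_ideal[OF J] k(3)] k(2)
      have "line_extension True (\<forall>z\<in>J. scalar_part z = 0) embed
          (iterated_dual k (ideal_bimodule q J) :: ('a unitization, 'u) bimodule)
          (iterated_dual k (ideal_bimodule p (embed -` J)) :: ('a, 'u) bimodule)" by simp
      then show "inner_derivation (strong_dual (iterated_dual k (ideal_bimodule q J) :: ('a unitization, 'u) bimodule)) D"
        using unital_bimodule_iterated_dual[OF Q.topological_bimodule_ideal[OF J] room lepoll' unital k(3)]
          inner[OF I] vanish D
        by (rule inner_derivation_extension[OF X Y])
    qed
  qed
qed

end
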